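(* Let $n,s\ge1$, $h>0$, $a_{ij},b_i\in\mathbb{R}$ with all $b_i\ne0$, and let $L\colon SO(n)\times\mathrm{Skew}(n)\to\mathbb{R}$ be a smooth hyperregular left-trivialized Lagrangian with corresponding left-trivialized Hamiltonian $H\colon SO(n)\times\mathrm{Skew}(n)\to\mathbb{R}$. Let $g_0,g_1,U_1,\dots,U_s\in SO(n)$, $\Omega_1,\dots,\Omega_s,\Lambda,p_0,p_1\in\mathrm{Skew}(n)$ be such that each $A_i:=g_0+h\sum_{j=1}^s a_{ij}U_j\Omega_j$ and $g_0+h\sum_{i=1}^s b_iU_i\Omega_i$ have positive determinant and the linear map $\tilde\phi$ (defined in the context) is invertible. Put $\mu_i:=\frac{\partial L}{\partial\Omega}(U_i,\Omega_i)$. Then the Lagrangian variational integrator equations $$\begin{cases}0=h\sum_{i=1}^s b_i(\tilde\pi_i\circ\tilde\phi^{-1}\circ\tilde\psi_k)^*\big(\frac{\partial L}{\partial U}(U_i,\Omega_i)+\mathrm{Asym}(U_i^Tg_1\Lambda\Omega_i^T)\big)+b_k\big(\frac{\partial L}{\partial\Omega}(U_k,\Omega_k)+\mathrm{Asym}(U_k^Tg_1\Lambda)\big),\\ g_1=\mathbb{P}\big(g_0+h\sum_{i=1}^s b_iU_i\Omega_i\big),\\ U_i=\mathbb{P}\big(g_0+h\sum_{j=1}^s a_{ij}U_j\Omega_j\big),\\ -p_0=h\sum_{i=1}^s b_i(\tilde\pi_i\circ\tilde\phi^{-1}\circ\tilde\varphi)^*\big(\frac{\partial L}{\partial U}(U_i,\Omega_i)+\mathrm{Asym}(U_i^Tg_1\Lambda\Omega_i^T)\big)+\mathrm{Asym}(g_0^Tg_1\Lambda),\\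 p_1=\mathrm{Asym}\big(g_1^T(g_0+h\sum_{i=1}^s b_iU_i\Omega_i)\Lambda^T\big)\end{cases}$$ (for all $i,k=1,\dots,s$) hold if and only if the Hamiltonian equations $$\begin{cases}\mu_k=-\mathrm{Asym}(U_k^Tg_1\Lambda)+h\sum_{i=1}^s\frac{b_i}{b_k}(\tilde\pi_i\circ\tilde\phi^{-1}\circ\tilde\psi_k)^*\big(\frac{\partial H}{\partial U}(U_i,\mu_i)-\mathrm{Asym}(U_i^Tg_1\Lambda\Omega_i^T)\big),\\ g_1=\mathbb{P}\big(g_0+h\sum_{i=1}^s b_iU_i\Omega_i\big),\\ U_i=\mathbb{P}\big(g_0+h\sum_{j=1}^s a_{ij}U_j\Omega_j\big),\\ \mathrm{Asym}(g_0^Tg_1\Lambda)=-p_0+h\sum_{i=1}^s b_i(\tilde\pi_i\circ\tilde\phi^{-1}\circ\tilde\varphi)^*\big(\frac{\partial H}{\partial U}(U_i,\mu_i)-\mathrm{Asym}(U_i^Tg_1\Lambda\Omega_i^T)\big),\\ p_1=\mathrm{Asym}\big(g_1^T(g_0+h\sum_{i=1}^s b_iU_i\Omega_i)\Lambda^T\big),\\ \Omega_i=\frac{\partial H}{\partial\mu}(U_i,\mu_i)\end{cases}$$ (for all $i,k=1,\dots,s$) hold.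
   Context: $\mathrm{Skew}(n)$ is the space of real skew-symmetric $n\times n$ matrices, with inner product $\langle\Omega,\tilde\Omega\rangle=\sum_{i<j}\Omega_{ij}\tilde\Omega_{ij}=\tfrac12\mathrm{tr}(\Omega\tilde\Omega^T)$, used to identify $\mathrm{Skew}(n)^*$ with $\mathrm{Skew}(n)$; $\mathrm{Skew}(n)^s$ carries the sum of the inner products; $^*$ denotes the adjoint with respect to these. $\mathrm{Asym}(A)=A-A^T$. Hyperregular means that $(U,\Omega)\mapsto(U,\frac{\partial L}{\partial\Omega}(U,\Omega))$ is a diffeomorphism of $SO(n)\times\mathrm{Skew}(n)$; the corresponding Hamiltonian is $H(U,\mu)=\langle\mu,\Omega\rangle-L(U,\Omega)$ with $\Omega$ determined by $\mu=\frac{\partial L}{\partial\Omega}(U,\Omega)$. Polar projection: every $A\in\mathbb{R}^{n\times n}$ with $\det A>0$ is uniquely $A=UP$ with $U\in SO(n)$ and $P$ symmetric positive-definite; $\mathbb{P}(A):=U$. Its left-trivialized tangent map $d\mathbb{P}_A\colon\mathbb{R}^{n\times n}\to\mathrm{Skew}(n)$ is defined by: if $A(0)=A$, $\dot A(0)=B$, $U(t)=\mathbb{P}(A(t))$, then $\dot U(0)=\mathbb{P}(A)\,d\mathbb{P}_A(B)$. Linear maps (with $A_i=g_0+h\sum_ja_{ij}U_j\Omega_j$): - $\tilde\psi_k\colon\mathrm{Skew}(n)\to\mathrm{Skew}(n)^s$, $\tilde\psi_k(\delta)=\{d\mathbb{P}_{A_i}(a_{ik}U_k\delta)\}_{i=1}^s$;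 - $\tilde\phi\colon\mathrm{Skew}(n)^s\to\mathrm{Skew}(n)^s$, $\tilde\phi(\{X_i\})=\{X_i-d\mathbb{P}_{A_i}(h\sum_{j=1}^s a_{ij}U_jX_j\Omega_j)\}_{i=1}^s$; - $\tilde\pi_i\colon\mathrm{Skew}(n)^s\to\mathrm{Skew}(n)$, the $i$-th coordinate projection; - $\tilde\varphi\colon\mathrm{Skew}(n)\to\mathrm{Skew}(n)^s$, $\tilde\varphi(\delta)=\{d\mathbb{P}_{A_i}(g_0\delta)\}_{i=1}^s$. $\partial/\partial\Omega$ and $\partial/\partial\mu$ are gradients in $\mathrm{Skew}(n)$ with respect to $\langle\cdot,\cdot\rangle$. Derivatives in the group variable are left-trivialized: $\frac{\partial f}{\partial U}\in\mathrm{Skew}(n)$ is defined by $\frac{d}{dt}\big|_{t=0}f(U(t))=\langle\frac{\partial f}{\partial U},\eta\rangle$ for $U(0)=U$, $\dot U(0)=U\eta$, $\eta\in\mathrm{Skew}(n)$. *)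

theory Defs
  imports "HOL-Analysis.Analysis"
begin

section \<open>The inner product space of skew-symmetric matrices\<close>

typedef 'n::finite skew = "{X :: real^'n^'n. transpose X = - X}"
  morphisms skew_mat Abs_skew
  by (rule exI[of _ 0]) (simp add: transpose_def vec_eq_iff)

setup_lifting type_definition_skew

lemmas skew_eq_iff = skew_mat_inject[symmetric]

lemma transpose_simps:
  fixes X Y :: "real^'n^'m"
  shows "transpose 0 = (0 :: real^'n^'m)" "transpose (- X) = - transpose X"
    "transpose (X + Y) = transpose X + transpose Y" "transpose (X - Y) = transpose X - transpose Y"
    "transpose (r *\<^sub>R X) = r *\<^sub>R transpose X"
  by (simp_all add: transpose_def vec_eq_iff)

instantiation skew :: (finite) real_vector
begin

lift_definition zero_skew :: "'a skew" is 0
  by (simp add: transpose_simps)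

lift_definition plus_skew :: "'a skew \<Rightarrow> 'a skew \<Rightarrow> 'a skew" is "(+)"
  by (simp add: transpose_simps)

lift_definition minus_skew :: "'a skew \<Rightarrow> 'a skew \<Rightarrow> 'a skew" is "(-)"
  by (simp add: transpose_simps)

lift_definition uminus_skew :: "'a skew \<Rightarrow> 'a skew" is uminus
  by (simp add: transpose_simps)

lift_definition scaleR_skew :: "real \<Rightarrow> 'a skew \<Rightarrow> 'a skew" is scaleR
  by (simp add: transpose_simps)

instance
  by standard
    (simp_all add: skew_eq_iff plus_skew.rep_eq minus_skew.rep_eq uminus_skew.rep_eq
      zero_skew.rep_eq scaleR_skew.rep_eq scaleR_add_right scaleR_add_left)

end

lemma trace_mult_transpose: "trace (X ** transpose Y) = X \<bullet> (Y :: real^'n^'n)"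
  by (simp add: trace_def matrix_matrix_mult_def transpose_def inner_vec_def)

text \<open>The inner product is half of the Frobenius inner product of matrices, so that it counts
  every off-diagonal pair of entries once.\<close>

instantiation skew :: (finite) real_inner
begin

definition inner_skew :: "'a skew \<Rightarrow> 'a skew \<Rightarrow> real"
  where "inner_skew X Y = trace (skew_mat X ** transpose (skew_mat Y)) / 2"

definition norm_skew :: "'a skew \<Rightarrow> real"
  where "norm_skew X = sqrt (inner X X)"

definition sgn_skew :: "'a skew \<Rightarrow> 'a skew"
  where "sgn_skew X = X /\<^sub>R norm X"

definition dist_skew :: "'a skew \<Rightarrow> 'a skew \<Rightarrow> real"
  where "dist_skew X Y = norm (X - Y)"

definition uniformity_skew :: "('a skew \<times> 'a skew) filter"
  where "uniformity_skew = (INF e\<in>{0 <..}. principal {(X, Y). dist X Y < e})"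

definition open_skew :: "'a skew set \<Rightarrow> bool"
  where "open_skew S = (\<forall>X\<in>S. \<forall>\<^sub>F (X', Y) in uniformity. X' = X \<longrightarrow> Y \<in> S)"

instance
proof
  fix x y z :: "'a skew" and r :: real
  show "inner x y = inner y x"
    by (simp add: inner_skew_def trace_mult_transpose inner_commute)
  show "inner (x + y) z = inner x z + inner y z"
    by (simp add: inner_skew_def trace_mult_transpose plus_skew.rep_eq inner_add_left
        add_divide_distrib)
  show "inner (r *\<^sub>R x) y = r * inner x y"
    by (simp add: inner_skew_def trace_mult_transpose scaleR_skew.rep_eq)
  show "0 \<le> inner x x"
    by (simp add: inner_skew_def trace_mult_transpose)
  show "inner x x = 0 \<longleftrightarrow> x = 0"
    by (simp add: inner_skew_def trace_mult_transpose skew_eq_iff zero_skew.rep_eq)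
qed (fact norm_skew_def sgn_skew_def dist_skew_def uniformity_skew_def open_skew_def)+

end

lift_definition Asym :: "real^'n^'n \<Rightarrow> 'n::finite skew" is "\<lambda>A. A - transpose A"
  by (simp add: transpose_simps)


section \<open>Smooth maps\<close>

text \<open>For an open subset \<open>W\<close> of a finite-dimensional space (the only case used below) the
  following is the usual class \<open>C\<^sup>k\<close>; the derivative is tested on fixed directions \<open>v\<close> so that the
  recursion stays within one type.\<close>

fun Ck_on :: "nat \<Rightarrow> ('a::real_normed_vector \<Rightarrow> 'b::real_normed_vector) \<Rightarrow> 'a set \<Rightarrow> bool" where
  "Ck_on 0 f W \<longleftrightarrow> continuous_on W f"
| "Ck_on (Suc k) f W \<longleftrightarrow>
     (\<forall>x\<in>W. f differentiable (at x)) \<and> (\<forall>v. Ck_on k (\<lambda>x. frechet_derivative f (at x) v) W)"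

text \<open>Smoothness on an arbitrary subset of a vector space means existence of local smooth
  extensions; on an embedded submanifold this is the intrinsic notion of smoothness.\<close>

definition smooth_map_on ::
  "'a set \<Rightarrow> ('a::real_normed_vector \<Rightarrow> 'b::real_normed_vector) \<Rightarrow> bool" where
  "smooth_map_on M f \<longleftrightarrow>
     (\<forall>x\<in>M. \<exists>W g. open W \<and> x \<in> W \<and> (\<forall>k. Ck_on k g W) \<and> (\<forall>y\<in>M \<inter> W. g y = f y))"

definition diffeomorphism_between ::
  "'a set \<Rightarrow> 'b set \<Rightarrow> ('a::real_normed_vector \<Rightarrow> 'b::real_normed_vector) \<Rightarrow> bool" where
  "diffeomorphism_between M N f \<longleftrightarrow>
     bij_betw f M N \<and> smooth_map_on M f \<and> smooth_map_on N (inv_into M f)"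


section \<open>Left-trivialized Lagrangians and Hamiltonians\<close>

definition SO :: "(real^'n^'n) set" where
  "SO = {U. rotation_matrix U}"

definition grad_skew :: "((real^'n^'n) \<times> 'n::finite skew \<Rightarrow> real) \<Rightarrow> real^'n^'n \<Rightarrow> 'n skew \<Rightarrow> 'n skew"
  where "grad_skew F U X = (THE G. GDERIV (\<lambda>Y. F (U, Y)) X :> G)"

definition grad_group :: "((real^'n^'n) \<times> 'n::finite skew \<Rightarrow> real) \<Rightarrow> real^'n^'n \<Rightarrow> 'n skew \<Rightarrow> 'n skew"
  where "grad_group F U X =
    (THE G. \<forall>\<gamma> \<eta>. (\<forall>t. \<gamma> t \<in> SO) \<and> \<gamma> 0 = U \<and>
                  (\<gamma> has_vector_derivative U ** skew_mat \<eta>) (at 0) \<longrightarrow>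
                ((\<lambda>t. F (\<gamma> t, X)) has_real_derivative (G \<bullet> \<eta>)) (at 0))"

definition hyperregular :: "((real^'n^'n) \<times> 'n::finite skew \<Rightarrow> real) \<Rightarrow> bool" where
  "hyperregular L \<longleftrightarrow>
     diffeomorphism_between (SO \<times> UNIV) (SO \<times> UNIV) (\<lambda>(U, X). (U, grad_skew L U X))"

definition hamiltonian :: "((real^'n^'n) \<times> 'n::finite skew \<Rightarrow> real) \<Rightarrow> (real^'n^'n) \<times> 'n skew \<Rightarrow> real"
  where "hamiltonian L = (\<lambda>(U, \<mu>).
    let X = (THE X. grad_skew L U X = \<mu>) in \<mu> \<bullet> X - L (U, X))"


section \<open>The polar projection and its left-trivialized tangent map\<close>

text \<open>\<open>polar A\<close> and \<open>dpolar A B\<close> are meaningful only for \<open>det A > 0\<close>; a curve through such an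
  \<open>A\<close> stays in that open set near \<open>t = 0\<close>, so no further restriction on it is needed.\<close>

definition positive_definite :: "real^'n^'n \<Rightarrow> bool" where
  "positive_definite P \<longleftrightarrow> (\<forall>x. x \<noteq> 0 \<longrightarrow> x \<bullet> (P *v x) > 0)"

definition polar :: "real^'n^'n \<Rightarrow> real^'n^'n" where
  "polar A = (THE U. U \<in> SO \<and> (\<exists>P. transpose P = P \<and> positive_definite P \<and> A = U ** P))"

definition dpolar :: "real^'n^'n \<Rightarrow> real^'n^'n \<Rightarrow> 'n::finite skew" where
  "dpolar A B =
    (THE X. \<forall>\<alpha>. \<alpha> 0 = A \<and> (\<alpha> has_vector_derivative B) (at 0) \<longrightarrow>
      ((\<lambda>t. polar (\<alpha> t)) has_vector_derivative polar A ** skew_mat X) (at 0))"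


section \<open>The linear maps of the integrator\<close>

text \<open>\<open>A\<close> is the family of internal stages before projection.  The \<open>s\<close>-fold power of the
  skew-symmetric matrices is the type \<open>('n skew)^'s\<close>, whose library inner product is the
  sum of the componentwise ones.\<close>

definition psi_tilde ::
  "('s \<Rightarrow> 's \<Rightarrow> real) \<Rightarrow> ('s \<Rightarrow> real^'n^'n) \<Rightarrow> ('s \<Rightarrow> real^'n^'n) \<Rightarrow> 's
    \<Rightarrow> 'n::finite skew \<Rightarrow> ('n skew)^'s::finite" where
  "psi_tilde a A U k \<delta> = (\<chi> i. dpolar (A i) (a i k *\<^sub>R (U k ** skew_mat \<delta>)))"

definition phi_tilde ::
  "real \<Rightarrow> ('s \<Rightarrow> 's \<Rightarrow> real) \<Rightarrow> ('s \<Rightarrow> real^'n^'n) \<Rightarrow> ('s \<Rightarrow> real^'n^'n) \<Rightarrow> ('s \<Rightarrow> 'n skew)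
    \<Rightarrow> ('n::finite skew)^'s::finite \<Rightarrow> ('n skew)^'s" where
  "phi_tilde h a A U \<Omega> X =
    (\<chi> i. X $ i -
      dpolar (A i) (h *\<^sub>R (\<Sum>j\<in>UNIV. a i j *\<^sub>R (U j ** skew_mat (X $ j) ** skew_mat (\<Omega> j)))))"

definition pi_tilde :: "'s \<Rightarrow> ('n::finite skew)^'s::finite \<Rightarrow> 'n skew" where
  "pi_tilde i X = X $ i"

definition varphi_tilde ::
  "('s \<Rightarrow> real^'n^'n) \<Rightarrow> real^'n^'n \<Rightarrow> 'n::finite skew \<Rightarrow> ('n skew)^'s::finite" where
  "varphi_tilde A g0 \<delta> = (\<chi> i. dpolar (A i) (g0 ** skew_mat \<delta>))"

end

(*
  By the chain rule the Legendre transform satisfies dH/dmu = Omega and dH/dU = - dL/dU at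
  mu = dL/dOmega, so the two systems agree term by term once the adjoints are known to be odd.
  An adjoint is only well behaved for a linear map, hence the derivative of the polar projection
  must be shown to exist.  For det A > 0 a maximiser of <A, U> over the orthogonal group is a polar
  factor of A.  The symmetric factor P depends differentiably on A since Q^2 - P^2 = Q X + X P for
  X = Q - P, where the left factor is nonnegative and the right one coercive when paired with X.
*)

theory Submission
  imports Defs
begin

section \<open>Polar decomposition\<close>

interpretation matrix_mult: bounded_bilinear "(**) :: real^'n^'m \<Rightarrow> real^'p^'n \<Rightarrow> real^'p^'m"
proof -
  have "bilinear ((**) :: real^'n^'m \<Rightarrow> real^'p^'n \<Rightarrow> real^'p^'m)"
    unfolding bilinear_def linear_iff
    by (simp add: matrix_matrix_mult_def vec_eq_iff algebra_simps sum.distrib sum_distrib_left)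
  then show "bounded_bilinear ((**) :: real^'n^'m \<Rightarrow> real^'p^'n \<Rightarrow> real^'p^'m)"
    by (simp add: bilinear_conv_bounded_bilinear)
qed

lemma bounded_linear_transpose: "bounded_linear (transpose :: real^'n^'m \<Rightarrow> real^'m^'n)"
  by (rule linear_conv_bounded_linear[THEN iffD1]) (simp add: linear_iff transpose_simps)

section \<open>The Frobenius inner product and the orthogonal group\<close>

lemma inner_transpose_transpose: "transpose X \<bullet> transpose Y = X \<bullet> (Y :: real^'n^'m)"
  unfolding inner_vec_def transpose_def by (subst sum.swap) simp

lemma inner_matrix_mult_left:
  fixes M X Y :: "real^'n^'n"
  shows "(M ** X) \<bullet> Y = X \<bullet> (transpose M ** Y)"
proof -
  have "(M ** X) \<bullet> Y = trace (M ** (X ** transpose Y))"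
    by (simp add: matrix_mul_assoc flip: trace_mult_transpose)
  also have "\<dots> = trace ((X ** transpose Y) ** M)"
    by (rule trace_mul_sym)
  also have "\<dots> = X \<bullet> (transpose M ** Y)"
    by (simp add: matrix_transpose_mul matrix_mul_assoc flip: trace_mult_transpose)
  finally show ?thesis .
qed

lemma inner_outer_product: "P \<bullet> (\<chi> i j. v $ i * w $ j) = v \<bullet> (P *v (w :: real^'n))"
  by (simp add: inner_vec_def matrix_vector_mult_def sum_distrib_left mult_ac)

text \<open>Besides compactness, this fixed value gives bounds on Cayley transforms and on polar
  factors that are uniform in their argument.\<close>

lemma norm_orthogonal_matrix:
  assumes "orthogonal_matrix (Q :: real^'n^'n)"
  shows "norm Q = sqrt (real CARD('n))"
proof -
  have "Q \<bullet> Q = trace (Q ** transpose Q)"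
    by (simp add: trace_mult_transpose)
  also have "\<dots> = real CARD('n)"
    using assms by (simp add: orthogonal_matrix_def trace_def mat_def)
  finally show ?thesis by (simp add: norm_eq_sqrt_inner)
qed

lemma compact_orthogonal_matrices: "compact {Q :: real^'n^'n. orthogonal_matrix Q}"
proof -
  have "{Q :: real^'n^'n. orthogonal_matrix Q} = {Q. transpose Q ** Q = mat 1}"
    by (auto simp: orthogonal_matrix)
  then have "closed {Q :: real^'n^'n. orthogonal_matrix Q}"
    by (simp add: closed_Collect_eq matrix_mult.continuous_on bounded_linear.continuous_on[OF bounded_linear_transpose] continuous_intros)
  moreover have "bounded {Q :: real^'n^'n. orthogonal_matrix Q}"
    by (rule boundedI[of _ "sqrt (real CARD('n))"]) (simp add: norm_orthogonal_matrix)
  ultimately show ?thesis by (simp add: compact_eq_bounded_closed)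
qed

section \<open>Cayley transforms and the optimality conditions for a maximiser at the
  identity\<close>

lemma matrix_minus_mult_vec: "(- (K :: real^'n^'m)) *v x = - (K *v x)"
  by (simp add: matrix_vector_mult_def vec_eq_iff sum_negf)

lemma skew_inner_mult_self:
  assumes "transpose (K :: real^'n^'n) = - K"
  shows "x \<bullet> (K *v x) = 0"
proof -
  have "x \<bullet> (K *v x) = (x v* K) \<bullet> x"
    by (simp add: dot_lmul_matrix)
  also have "\<dots> = (transpose K *v x) \<bullet> x"
    by simp
  also have "\<dots> = - (x \<bullet> (K *v x))"
    using assms by (simp add: inner_commute matrix_minus_mult_vec del: transpose_matrix_vector)
  finally show ?thesis by simp
qed

text \<open>Here \<open>N = (1 - K)\<^sup>-\<^sup>1\<close>, so that \<open>2 N - 1 = (1 + K) (1 - K)\<^sup>-\<^sup>1\<close> is the Cayley transform of \<open>K\<close>.\<close>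

lemma cayley:
  assumes K: "transpose (K :: real^'n^'n) = - K"
  obtains N where "orthogonal_matrix ((2::real) *\<^sub>R N - mat 1)" "N = mat 1 + K ** N"
proof -
  have "inj ((*v) (mat 1 - K))"
  proof (rule linear_injective_0[THEN iffD2, OF _ ]; (intro allI impI)?)
    fix x assume "(mat 1 - K) *v x = 0"
    \<comment> \<open>Pairing with \<open>x\<close> removes the skew part: a real skew-symmetric
      matrix does not have the eigenvalue 1.\<close>
    then have "x \<bullet> (x - K *v x) = 0"
      by (simp add: matrix_vector_mult_diff_rdistrib)
    then show "x = 0"
      by (simp add: inner_diff_right skew_inner_mult_self[OF K])
  qed simp
  then obtain N where N: "N ** (mat 1 - K) = mat 1"
    using matrix_left_invertible_injective by blast
  then have N': "(mat 1 - K) ** N = mat 1"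
    using matrix_left_right_inverse by blast
  then have eq: "N = mat 1 + K ** N"
    by (simp add: matrix_mult.diff_left algebra_simps)
  have tN: "transpose N ** (mat 1 + K) = mat 1" "(mat 1 + K) ** transpose N = mat 1"
    using arg_cong[OF N, of transpose] arg_cong[OF N', of transpose] K
    by (simp_all add: matrix_transpose_mul transpose_simps)
  have R: "2 *\<^sub>R N - mat 1 = (mat 1 + K) ** N"
    using eq by (simp add: matrix_mult.add_left algebra_simps scaleR_2)
  have "transpose ((mat 1 + K) ** N) ** ((mat 1 + K) ** N)
      = transpose N ** ((mat 1 - K) ** (mat 1 + K)) ** N"
    by (simp add: matrix_transpose_mul transpose_simps K matrix_mul_assoc)
  \<comment> \<open>Both factors are polynomials in \<open>K\<close>, so they commute and each can
    be cancelled against its own inverse.\<close>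
  also have "(mat 1 - K) ** (mat 1 + K) = (mat 1 + K) ** (mat 1 - K)"
    by (simp add: matrix_mult.add_left matrix_mult.add_right matrix_mult.diff_left matrix_mult.diff_right)
  also have "transpose N ** ((mat 1 + K) ** (mat 1 - K)) ** N
      = (transpose N ** (mat 1 + K)) ** ((mat 1 - K) ** N)"
    by (simp add: matrix_mul_assoc)
  also have "\<dots> = mat 1" by (simp add: tN N')
  finally have "orthogonal_matrix (2 *\<^sub>R N - mat 1)"
    unfolding R by (simp add: orthogonal_matrix)
  then show thesis using eq by (rule that)
qed

text \<open>Maximality is tested on the Cayley transforms of \<open>t K\<close> for \<open>K = P - P\<^sup>T\<close> and \<open>t \<rightarrow> 0\<close>.\<close>

lemma orthogonal_maximiser_symmetric:
  assumes max: "\<And>R. orthogonal_matrix R \<Longrightarrow> P \<bullet> R \<le> P \<bullet> (mat 1 :: real^'n^'n)"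
  shows "transpose P = P"
proof -
  define K where "K = P - transpose P"
  have K: "transpose K = - K"
    by (simp add: K_def transpose_simps)
  \<comment> \<open>Since \<open>2 N - 1\<close> is orthogonal, \<open>c\<close> bounds
    \<open>N\<close> uniformly in \<open>t\<close>, which makes the remainder below of order
    \<open>t\<close>.\<close>
  define c where "c = sqrt (real CARD('n)) + norm (mat 1 :: real^'n^'n)"
  obtain B where B: "B > 0" "\<And>(X :: real^'n^'n) (Y :: real^'n^'n). norm (X ** Y) \<le> norm X * norm Y * B"
    using matrix_mult.pos_bounded by blast
  have bound: "P \<bullet> K \<le> t * (norm P * (norm (K ** K) * c * B))" if t: "t > 0" for t
  proof -
    have "transpose (t *\<^sub>R K) = - (t *\<^sub>R K)"
      by (simp add: transpose_simps K)
    then obtain N where N: "orthogonal_matrix (2 *\<^sub>R N - mat 1)" "N = mat 1 + (t *\<^sub>R K) ** N"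
      by (rule cayley)
    have "norm ((2::real) *\<^sub>R N) \<le> c"
      using norm_triangle_sub[of "2 *\<^sub>R N" "mat 1"] norm_orthogonal_matrix[OF N(1)]
      by (simp add: c_def)
    then have nN: "norm N \<le> c"
      using norm_ge_zero[of N] unfolding norm_scaleR by linarith
    have "2 *\<^sub>R N - mat 1 = mat 1 + (2 * t) *\<^sub>R (K ** N)"
    proof -
      have "2 *\<^sub>R N - mat 1 = 2 *\<^sub>R (mat 1 + (t *\<^sub>R K) ** N) - mat 1"
        using N(2) by simp
      then show ?thesis
        by (simp add: scaleR_add_right scaleR_2 matrix_mult.scaleR_left)
    qed
    then have "P \<bullet> mat 1 + (2 * t) * (P \<bullet> (K ** N)) \<le> P \<bullet> mat 1"
      using max[OF N(1)] by (simp add: inner_add_right)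
    then have le: "P \<bullet> (K ** N) \<le> 0"
      using t by (simp add: mult_le_0_iff)
    \<comment> \<open>One step of the resolvent expansion isolates the part of \<open>K ** N\<close>
      that survives as \<open>t\<close> tends to 0.\<close>
    have "K ** N = K + t *\<^sub>R (K ** K ** N)"
      by (subst N(2)) (simp add: matrix_mult.add_right matrix_mult.scaleR_left
        matrix_mult.scaleR_right matrix_mul_assoc)
    then have "P \<bullet> K \<le> t * (- (P \<bullet> (K ** K ** N)))"
      using le by (simp add: inner_add_right)
    also have "- (P \<bullet> (K ** K ** N)) \<le> norm P * norm (K ** K ** N)"
      using Cauchy_Schwarz_ineq2[of P "K ** K ** N"] by linarith
    also have "\<dots> \<le> norm P * (norm (K ** K) * norm N * B)"
      by (intro mult_left_mono B(2) norm_ge_zero)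
    also have "\<dots> \<le> norm P * (norm (K ** K) * c * B)"
      using nN B(1) by (intro mult_left_mono mult_right_mono) auto
    finally show ?thesis using t by simp
  qed
  have "P \<bullet> K \<le> 0"
  proof (rule tendsto_le)
    show "((\<lambda>t. t * (norm P * (norm (K ** K) * c * B))) \<longlongrightarrow> 0) (at_right 0)"
      by (rule tendsto_eq_intros refl)+ simp
    show "((\<lambda>t. P \<bullet> K) \<longlongrightarrow> P \<bullet> K) (at_right (0::real))" by simp
    show "\<forall>\<^sub>F t in at_right 0. P \<bullet> K \<le> t * (norm P * (norm (K ** K) * c * B))"
      using bound by (auto simp: eventually_at_right_less intro: eventually_mono[OF eventually_at_right_less])
  qed simp
  \<comment> \<open>\<open>P \<bullet> K\<close> is half the squared norm of \<open>K\<close>, so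
    the inequality just obtained forces \<open>K = 0\<close>.\<close>
  moreover have "K \<bullet> K = 2 * (P \<bullet> K)"
  proof -
    have "transpose P \<bullet> K = P \<bullet> transpose K"
      by (metis inner_transpose_transpose transpose_transpose)
    then have "transpose P \<bullet> K = - (P \<bullet> K)" by (simp add: K)
    moreover have "K \<bullet> K = P \<bullet> K - transpose P \<bullet> K"
      by (metis K_def inner_diff_left)
    ultimately show ?thesis by simp
  qed
  ultimately have "K = 0"
    by (metis inner_ge_zero inner_eq_zero_iff mult_2 add_nonpos_nonpos antisym)
  then show ?thesis by (simp add: K_def)
qed

text \<open>Maximality is tested on the reflection along \<open>v\<close>.\<close>

lemma orthogonal_maximiser_nonneg:
  assumes max: "\<And>R. orthogonal_matrix R \<Longrightarrow> P \<bullet> R \<le> P \<bullet> (mat 1 :: real^'n^'n)"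
  shows "0 \<le> v \<bullet> (P *v v)"
proof (cases "v = 0")
  case False
  define E :: "real^'n^'n" where "E = (\<chi> i j. v $ i * v $ j)"
  define R where "R = mat 1 - (2 / (v \<bullet> v)) *\<^sub>R E"
  have tE: "transpose E = E"
    by (simp add: E_def transpose_def mult.commute)
  have EE: "E ** E = (v \<bullet> v) *\<^sub>R E"
    by (simp add: E_def matrix_matrix_mult_def vec_eq_iff inner_vec_def sum_distrib_left
        sum_distrib_right mult_ac)
  have "transpose R ** R = mat 1"
    using False by (simp add: R_def transpose_simps tE matrix_mult.diff_left matrix_mult.diff_right
        matrix_mult.scaleR_left matrix_mult.scaleR_right EE scaleR_2)
  then have "orthogonal_matrix R" by (simp add: orthogonal_matrix)
  then have "P \<bullet> mat 1 - (2 / (v \<bullet> v)) * (v \<bullet> (P *v v)) \<le> P \<bullet> mat 1"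
    using max[of R] by (simp add: R_def E_def inner_diff_right inner_outer_product)
  then show ?thesis
    using False by (simp add: zero_le_divide_iff zero_le_mult_iff not_le[of "v \<bullet> v" 0, THEN iffD2])
qed simp

text \<open>A zero \<open>x\<close> of the form is a minimiser, and moving from \<open>x\<close>
  against the direction \<open>y = P *v x\<close> would make the form negative unless
  \<open>y = 0\<close>.\<close>

lemma nonneg_quadratic_form_eq_0:
  fixes P :: "real^'n^'n"
  assumes sym: "transpose P = P" and nn: "\<And>v. 0 \<le> v \<bullet> (P *v v)" and x: "x \<bullet> (P *v x) = 0"
  shows "P *v x = 0"
proof -
  define y where "y = P *v x"
  define c where "c = y \<bullet> (P *v y)"
  \<comment> \<open>The form at \<open>x - t *\<^sub>R y\<close> is least at
    \<open>t = (y \<bullet> y) / c\<close>; the denominator \<open>c + 1\<close> also covers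
    \<open>c = 0\<close> and still gives a negative value for nonzero \<open>y\<close>.\<close>
  define t where "t = (y \<bullet> y) / (c + 1)"
  have c: "c \<ge> 0" using nn by (simp add: c_def)
  have 0: "x \<bullet> y = 0" using x by (simp add: y_def)
  have xy: "x \<bullet> (P *v y) = y \<bullet> y"
    by (metis dot_lmul_matrix sym transpose_matrix_vector y_def)
  have "0 \<le> (x - t *\<^sub>R y) \<bullet> (P *v (x - t *\<^sub>R y))" by (rule nn)
  also have "\<dots> = t * (t * c - 2 * (y \<bullet> y))"
    by (simp add: matrix_vector_mult_diff_distrib matrix_vector_mult_scaleR inner_diff_left
        inner_diff_right 0 xy c_def flip: y_def) (simp add: algebra_simps)
  also have "t * c - 2 * (y \<bullet> y) = - (y \<bullet> y) * ((c + 2) / (c + 1))"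
    using c by (simp add: t_def field_simps)
  also have "t * (- (y \<bullet> y) * ((c + 2) / (c + 1))) = - ((y \<bullet> y) * (y \<bullet> y) * ((c + 2) / (c + 1)\<^sup>2))"
    by (simp add: t_def power2_eq_square)
  finally have "(y \<bullet> y) * (y \<bullet> y) * ((c + 2) / (c + 1)\<^sup>2) \<le> 0"
    by linarith
  moreover have "(c + 2) / (c + 1)\<^sup>2 > 0" using c by simp
  ultimately have "(y \<bullet> y) * (y \<bullet> y) \<le> 0"
    by (metis mult_le_0_iff not_le)
  then have "(y \<bullet> y) * (y \<bullet> y) = 0"
    by (metis order_antisym zero_le_square)
  then show ?thesis by (simp add: y_def)
qed

section \<open>Positive definite matrices and existence of the decomposition\<close>

lemma continuous_on_det [continuous_intros]:
  fixes f :: "'a::topological_space \<Rightarrow> real^'n^'n"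
  assumes "continuous_on S f"
  shows "continuous_on S (\<lambda>x. det (f x))"
  unfolding det_def by (intro continuous_intros assms)

lemma positive_definite_injective:
  assumes "positive_definite (P :: real^'n^'n)" "P *v x = 0"
  shows "x = 0"
  using assms unfolding positive_definite_def by (metis inner_zero_right less_irrefl)

lemma positive_definite_invertible:
  assumes "positive_definite (P :: real^'n^'n)"
  shows "det P \<noteq> 0"
proof -
  have "inj ((*v) P)"
    using positive_definite_injective[OF assms] by (subst linear_injective_0) auto
  then show ?thesis
    by (metis invertible_det_nz invertible_left_inverse matrix_left_invertible_injective)
qed

text \<open>The segment from the identity to a positive definite matrix avoids the singular matrices.\<close>

lemma det_positive_definite:
  assumes pd: "positive_definite (P :: real^'n^'n)"
  shows "det P > 0"
proof (rule ccontr)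
  define f where "f t = det ((1 - t) *\<^sub>R mat 1 + t *\<^sub>R P)" for t
  assume "\<not> det P > 0"
  moreover have "continuous_on {0..1} f"
    unfolding f_def by (intro continuous_intros)
  ultimately obtain t where t: "0 \<le> t" "t \<le> 1" "f t = 0"
    using IVT2'[of f 1 0 0] by (auto simp: f_def)
  have "positive_definite ((1 - t) *\<^sub>R mat 1 + t *\<^sub>R P)"
    unfolding positive_definite_def
  proof (intro allI impI)
    fix x :: "real^'n" assume x: "x \<noteq> 0"
    have "x \<bullet> (((1 - t) *\<^sub>R mat 1 + t *\<^sub>R P) *v x) = (1 - t) * (x \<bullet> x) + t * (x \<bullet> (P *v x))"
      by (simp add: matrix_vector_mult_add_rdistrib inner_add_right flip: scaleR_matrix_vector_assoc)
    moreover have "x \<bullet> x > 0" "x \<bullet> (P *v x) > 0"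
      using x pd by (auto simp: positive_definite_def)
    then have "0 < (1 - t) * (x \<bullet> x) + t * (x \<bullet> (P *v x))"
      using t by (cases "t = 0") (auto intro: add_nonneg_pos)
    ultimately show "0 < x \<bullet> (((1 - t) *\<^sub>R mat 1 + t *\<^sub>R P) *v x)" by simp
  qed
  then show False
    using positive_definite_invertible t(3) by (auto simp: f_def)
qed

text \<open>The maximum is taken over all orthogonal matrices because the reflections that test
  nonnegativity have determinant -1. Once \<open>P\<close> is positive definite,
  \<open>det P > 0\<close> and \<open>det A > 0\<close> place the maximiser in
  \<open>SO\<close>.\<close>

lemma polar_decomposition_exists:
  assumes det: "det (A :: real^'n^'n) > 0"
  obtains U P where "U \<in> SO" "transpose P = P" "positive_definite P" "A = U ** P"
proof -
  have "continuous_on {Q :: real^'n^'n. orthogonal_matrix Q} ((\<bullet>) A)"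
    by (intro continuous_intros)
  moreover have "{Q :: real^'n^'n. orthogonal_matrix Q} \<noteq> {}"
    using orthogonal_matrix_id by auto
  ultimately obtain U where U: "orthogonal_matrix U"
      and max: "\<And>Q. orthogonal_matrix Q \<Longrightarrow> A \<bullet> Q \<le> A \<bullet> U"
    using continuous_attains_sup[OF compact_orthogonal_matrices] by blast
  define P where "P = transpose U ** A"
  have AP: "A = U ** P"
    using U by (simp add: P_def orthogonal_matrix_def matrix_mul_assoc)
  \<comment> \<open>Left translation by \<open>U\<close> carries the maximiser to the identity:
    \<open>P \<bullet> R\<close> equals \<open>A \<bullet> (U ** R)\<close>.\<close>
  have P: "P \<bullet> R \<le> P \<bullet> mat 1" if "orthogonal_matrix R" for R
    using max[OF orthogonal_matrix_mul[OF U that]] inner_matrix_mult_left[of "transpose U" A]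
    by (simp add: P_def)
  note sym = orthogonal_maximiser_symmetric[OF P]
  note nn = orthogonal_maximiser_nonneg[OF P]
  have detP: "det A = det U * det P"
    by (simp add: AP det_mul)
  have "x = 0" if "x \<bullet> (P *v x) = 0" for x
  proof -
    have "P *v x = 0" using nonneg_quadratic_form_eq_0[OF sym nn that] .
    moreover have "invertible P" using det detP by (auto simp: invertible_det_nz)
    ultimately show ?thesis
      by (metis inj_matrix_vector_mult inj_eq matrix_vector_mult_0_right)
  qed
  then have pd: "positive_definite P"
    unfolding positive_definite_def using nn by (metis less_eq_real_def)
  have "det P > 0"
    using pd by (rule det_positive_definite)
  then have "det U > 0" using det detP zero_less_mult_pos2 by metis
  then have "U \<in> SO"
    using U det_orthogonal_matrix[OF U] by (auto simp: SO_def rotation_matrix_def)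
  then show thesis using that sym pd AP by blast
qed

section \<open>Uniqueness and differentiability of the polar projection\<close>

text \<open>Cauchy-Schwarz applied to each entry, a row times a column. The constant 1 replaces the
  unspecified bound of a general bilinear map.\<close>

lemma norm_matrix_mult_le: "norm ((X :: real^'n^'m) ** (Y :: real^'p^'n)) \<le> norm X * norm Y"
proof -
  have "(norm (X ** Y))\<^sup>2 = (\<Sum>i\<in>UNIV. \<Sum>j\<in>UNIV. (X $ i \<bullet> column j Y)\<^sup>2)"
    unfolding power2_norm_eq_inner
    by (simp add: inner_vec_def power2_eq_square matrix_matrix_mult_def column_def)
  also have "\<dots> \<le> (\<Sum>i\<in>UNIV. \<Sum>j\<in>UNIV. (X $ i \<bullet> X $ i) * (column j Y \<bullet> column j Y))"
    by (intro sum_mono Cauchy_Schwarz_ineq)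
  also have "\<dots> = (X \<bullet> X) * (\<Sum>j\<in>UNIV. column j Y \<bullet> column j Y)"
    by (simp add: sum_product inner_vec_def[of X])
  also have "(\<Sum>j\<in>UNIV. column j Y \<bullet> column j Y) = transpose Y \<bullet> transpose Y"
    by (simp add: inner_vec_def column_def transpose_def)
  also have "\<dots> = Y \<bullet> Y" by (rule inner_transpose_transpose)
  finally have "(norm (X ** Y))\<^sup>2 \<le> (norm X * norm Y)\<^sup>2"
    by (simp add: power_mult_distrib power2_norm_eq_inner)
  then show ?thesis by (rule power2_le_imp_le) simp
qed

text \<open>Right multiplication by the symmetric \<open>P\<close> acts on each row of
  \<open>X\<close> as \<open>P\<close> acts on vectors, and the matrix inner product is the sum over
  rows.\<close>

lemma quadratic_form_mult_right:
  assumes sym: "transpose P = (P :: real^'n^'n)" and c: "\<And>x. c * (x \<bullet> x) \<le> x \<bullet> (P *v x)"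
  shows "c * (X \<bullet> X) \<le> X \<bullet> (X ** P)"
proof -
  have row: "(X ** P) $ i = P *v (X $ i)" for i
  proof -
    have "(X ** P) $ i = (X $ i) v* P"
      by (simp add: vec_eq_iff matrix_matrix_mult_def vector_matrix_mult_def mult.commute)
    then show ?thesis by (metis sym transpose_matrix_vector)
  qed
  have "c * (X \<bullet> X) = (\<Sum>i\<in>UNIV. c * (X $ i \<bullet> X $ i))"
    by (simp add: inner_vec_def[of X] sum_distrib_left)
  also have "\<dots> \<le> (\<Sum>i\<in>UNIV. X $ i \<bullet> (X ** P) $ i)"
    unfolding row by (intro sum_mono c)
  finally show ?thesis by (simp add: inner_vec_def[of X])
qed

lemma quadratic_form_mult_left:
  assumes sym: "transpose P = (P :: real^'n^'n)" and c: "\<And>x. c * (x \<bullet> x) \<le> x \<bullet> (P *v x)"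
  shows "c * (X \<bullet> X) \<le> X \<bullet> (P ** X)"
proof -
  have "c * (transpose X \<bullet> transpose X) \<le> transpose X \<bullet> (transpose X ** P)"
    using quadratic_form_mult_right[OF assms] .
  moreover have "transpose X ** P = transpose (P ** X)"
    by (simp add: matrix_transpose_mul sym)
  ultimately show ?thesis by (simp add: inner_transpose_transpose)
qed

text \<open>Compactness of the unit sphere makes strict positivity uniform: \<open>c\<close> is the
  minimum of the form there, and homogeneity does the rest.\<close>

lemma positive_definite_coercive:
  assumes "positive_definite (P :: real^'n^'n)"
  obtains c where "c > 0" "\<And>x. c * (x \<bullet> x) \<le> x \<bullet> (P *v x)"
proof -
  have "continuous_on (sphere 0 1) (\<lambda>x. x \<bullet> (P *v x))"
    by (intro continuous_intros linear_continuous_on) (simp add: linear_linear)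
  moreover have "sphere (0 :: real^'n) 1 \<noteq> {}"
    by simp
  ultimately obtain u where u: "norm u = 1" "\<And>x. norm x = 1 \<Longrightarrow> u \<bullet> (P *v u) \<le> x \<bullet> (P *v x)"
    using continuous_attains_inf[OF compact_sphere, of 0 1 "\<lambda>x. x \<bullet> (P *v x)"] by auto
  show thesis
  proof (rule that)
    show "u \<bullet> (P *v u) > 0"
      using assms u(1) unfolding positive_definite_def by (metis norm_zero zero_neq_one)
    show "u \<bullet> (P *v u) * (x \<bullet> x) \<le> x \<bullet> (P *v x)" for x
    proof (cases "x = 0")
      case False
      have "u \<bullet> (P *v u) \<le> (x /\<^sub>R norm x) \<bullet> (P *v (x /\<^sub>R norm x))"
        using False by (intro u(2)) simp
      also have "\<dots> = x \<bullet> (P *v x) / (x \<bullet> x)"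
        by (simp add: matrix_vector_mult_scaleR divide_simps flip: norm_eq_sqrt_inner power2_norm_eq_inner)
          (simp add: power2_eq_square)
      finally show ?thesis using False by (simp add: field_simps)
    qed simp
  qed
qed

text \<open>With \<open>X = Q - P\<close> one has \<open>Q X + X P = Q\<^sup>2 - P\<^sup>2\<close>, and pairing with \<open>X\<close> makes both terms on the
  left nonnegative.\<close>

lemma square_root_Lipschitz:
  fixes P Q :: "real^'n^'n"
  assumes P: "transpose P = P" "\<And>x. c * (x \<bullet> x) \<le> x \<bullet> (P *v x)"
    and Q: "transpose Q = Q" "positive_definite Q"
  shows "c * norm (Q - P) \<le> norm (Q ** Q - P ** P)"
proof (cases "Q = P")
  case False
  define X where "X = Q - P"
  have eq: "Q ** X + X ** P = Q ** Q - P ** P"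
    by (simp add: X_def matrix_mult.diff_left matrix_mult.diff_right)
  \<comment> \<open>Coercivity with constant 0 is mere nonnegativity, so the final constant depends
    on \<open>P\<close> and not on the varying \<open>Q\<close>.\<close>
  have "0 * (x \<bullet> x) \<le> x \<bullet> (Q *v x)" for x
    using Q(2) unfolding positive_definite_def by (cases "x = 0") (auto intro: less_imp_le)
  then have "0 * (X \<bullet> X) \<le> X \<bullet> (Q ** X)"
    by (rule quadratic_form_mult_left[OF Q(1)])
  moreover have "c * (X \<bullet> X) \<le> X \<bullet> (X ** P)"
    by (rule quadratic_form_mult_right[OF P])
  ultimately have "c * (X \<bullet> X) \<le> X \<bullet> (Q ** Q - P ** P)"
    by (simp add: inner_add_right flip: eq)
  also have "\<dots> \<le> norm X * norm (Q ** Q - P ** P)"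
    by (rule norm_cauchy_schwarz)
  finally have "norm X * (c * norm X) \<le> norm X * norm (Q ** Q - P ** P)"
    by (simp add: power2_eq_square mult_ac flip: power2_norm_eq_inner)
  moreover have "norm X > 0" using False by (simp add: X_def)
  ultimately show ?thesis by (simp add: X_def)
qed simp

lemma SO_orthogonal: "U \<in> SO \<Longrightarrow> transpose U ** U = mat 1" "U \<in> SO \<Longrightarrow> U ** transpose U = mat 1"
  by (auto simp: SO_def rotation_matrix_def orthogonal_matrix_def)

text \<open>Passing to \<open>transpose A ** A\<close> eliminates the orthogonal factor, so both
  symmetric factors have the same square; the Lipschitz estimate then makes them equal, and they can
  be cancelled.\<close>

lemma polar_decomposition_unique:
  fixes U V P Q :: "real^'n^'n"
  assumes U: "U \<in> SO" and P: "transpose P = P" "positive_definite P"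
    and V: "V \<in> SO" and Q: "transpose Q = Q" "positive_definite Q"
    and eq: "U ** P = V ** Q"
  shows "U = V"
proof -
  have sq: "transpose (W ** R) ** (W ** R) = R ** R"
    if "W \<in> SO" "transpose R = R" for W R :: "real^'n^'n"
  proof -
    have "transpose (W ** R) ** (W ** R) = R ** (transpose W ** W) ** R"
      by (simp add: matrix_transpose_mul matrix_mul_assoc that(2))
    then show ?thesis by (simp add: SO_orthogonal that(1))
  qed
  obtain c where c: "c > 0" "\<And>x. c * (x \<bullet> x) \<le> x \<bullet> (P *v x)"
    using positive_definite_coercive P(2) by blast
  have "c * norm (Q - P) \<le> norm (Q ** Q - P ** P)"
    by (rule square_root_Lipschitz[OF P(1) c(2) Q])
  also have "Q ** Q = P ** P"
    using sq[OF U P(1)] sq[OF V Q(1)] eq by simp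
  finally have "Q = P"
    using c(1) by (simp add: mult_le_0_iff)
  moreover obtain R where "P ** R = mat 1"
    using positive_definite_invertible[OF P(2)] by (metis invertible_def invertible_det_nz)
  ultimately show ?thesis
    using eq by (metis matrix_mul_assoc matrix_mul_rid)
qed

lemma polar_eqI:
  assumes "U \<in> SO" "transpose P = P" "positive_definite P"
  shows "polar (U ** P) = U"
  unfolding polar_def
proof (rule the_equality)
  show "V = U" if "V \<in> SO \<and> (\<exists>R. transpose R = R \<and> positive_definite R \<and> U ** P = V ** R)" for V
    using that assms by (auto dest: polar_decomposition_unique[of V _ U P])
qed (use assms in auto)

text \<open>For positive determinant this is the positive definite square root of
  \<open>transpose A ** A\<close>, the symmetric polar factor.\<close>

definition stretch :: "real^'n^'n \<Rightarrow> real^'n^'n" where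
  "stretch A = transpose (polar A) ** A"

lemma polar_stretch:
  assumes "det A > 0"
  shows "polar A \<in> SO" "transpose (stretch A) = stretch A" "positive_definite (stretch A)"
    "polar A ** stretch A = A" "stretch A ** stretch A = transpose A ** A"
proof -
  obtain U P where UP: "U \<in> SO" "transpose P = P" "positive_definite P" "A = U ** P"
    using polar_decomposition_exists[OF assms] .
  have pol: "polar A = U"
    unfolding UP(4) by (rule polar_eqI[OF UP(1-3)])
  have str: "stretch A = P"
    unfolding stretch_def pol by (subst UP(4)) (simp add: matrix_mul_assoc SO_orthogonal[OF UP(1)])
  show "polar A \<in> SO" "transpose (stretch A) = stretch A" "positive_definite (stretch A)"
    "polar A ** stretch A = A"
    using UP pol str by auto
  have "transpose A ** A = P ** (transpose U ** U) ** P"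
    by (simp add: UP(4) matrix_transpose_mul matrix_mul_assoc UP(2))
  then show "stretch A ** stretch A = transpose A ** A"
    by (simp add: SO_orthogonal[OF UP(1)] str)
qed

section \<open>Differentiability of the two polar factors\<close>

lemma eventually_det_pos:
  assumes "det (A :: real^'n^'n) > 0"
  shows "\<forall>\<^sub>F B in nhds A. det B > 0"
proof -
  have "open {B :: real^'n^'n. det B > 0}"
    by (intro open_Collect_less continuous_intros)
  then show ?thesis using assms by (auto simp: eventually_nhds)
qed

text \<open>The constant is a bound of the derivative plus 1 for the remainder; one endpoint stays
  fixed at \<open>x\<close>.\<close>

lemma has_derivative_eventually_Lipschitz:
  assumes "(f has_derivative f') (at x)"
  obtains C where "C \<ge> 0" "\<forall>\<^sub>F y in nhds x. norm (f y - f x) \<le> C * norm (y - x)"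
proof -
  have lim: "((\<lambda>y. norm (f y - f x - f' (y - x)) / norm (y - x)) \<longlongrightarrow> 0) (at x)"
    and bl: "bounded_linear f'"
    using assms by (auto simp: has_derivative_iff_norm)
  obtain K where K: "K \<ge> 0" "\<And>v. norm (f' v) \<le> norm v * K"
    using bounded_linear.nonneg_bounded[OF bl] by blast
  have "\<forall>\<^sub>F y in at x. norm (f y - f x - f' (y - x)) / norm (y - x) < 1"
    using order_tendstoD(2)[OF lim] by simp
  then have "\<forall>\<^sub>F y in at x. norm (f y - f x) \<le> (K + 1) * norm (y - x)"
    using eventually_neq_at_within[of x x UNIV]
  proof eventually_elim
    case (elim y)
    then have "norm (f y - f x - f' (y - x)) \<le> norm (y - x)"
      by (simp add: divide_less_eq)
    moreover have "norm (f y - f x) \<le> norm (f y - f x - f' (y - x)) + norm (f' (y - x))"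
      using norm_triangle_sub[of "f y - f x" "f' (y - x)"] by simp
    ultimately show ?case using K(2)[of "y - x"] by (simp add: algebra_simps)
  qed
  then have "\<forall>\<^sub>F y in nhds x. norm (f y - f x) \<le> (K + 1) * norm (y - x)"
    by (auto simp: eventually_nhds_conv_at)
  then show thesis using K(1) that[of "K + 1"] by simp
qed

text \<open>This transfers differentiability from an explicit approximant \<open>f\<close> to
  \<open>g\<close>; at \<open>y = x\<close> the bound already forces
  \<open>g x = f x\<close>.\<close>

lemma has_derivative_quadratic_remainder:
  assumes f: "(f has_derivative f') (at x)"
    and r: "\<forall>\<^sub>F y in nhds x. norm (g y - f y) \<le> C * (norm (y - x))\<^sup>2"
  shows "(g has_derivative f') (at x)"
proof -
  have gx: "g x = f x"
    using eventually_nhds_x_imp_x[OF r] by simp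
  have "((\<lambda>y. g y - f y) has_derivative (\<lambda>v. 0)) (at x)"
    unfolding has_derivative_iff_norm
  proof (intro conjI bounded_linear_zero)
    have "((\<lambda>y. C * norm (y - x)) \<longlongrightarrow> C * norm (x - x)) (at x)"
      by (intro tendsto_intros)
    then have lim: "((\<lambda>y. C * norm (y - x)) \<longlongrightarrow> 0) (at x)"
      by simp
    have "\<forall>\<^sub>F y in at x. norm (norm ((g y - f y) - (g x - f x) - 0) / norm (y - x)) \<le> C * norm (y - x)"
      using r[THEN filter_leD[OF at_within_le_nhds, of _ _ UNIV]] eventually_neq_at_within[of x x UNIV]
      by eventually_elim (simp add: gx divide_le_eq power2_eq_square mult.assoc)
    then show "((\<lambda>y. norm ((g y - f y) - (g x - f x) - 0) / norm (y - x)) \<longlongrightarrow> 0) (at x)"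
      by (rule Lim_null_comparison[OF _ lim])
  qed
  from has_derivative_add[OF f this] show ?thesis by simp
qed

text \<open>Writing \<open>X = stretch B - P\<close>, the equation \<open>P X + X P + X\<^sup>2 = B\<^sup>T B - A\<^sup>T A\<close> determines \<open>X\<close> up to the
  term \<open>X\<^sup>2\<close>, which is quadratically small, because the Sylvester operator \<open>S\<close> is invertible.\<close>

lemma stretch_differentiable:
  assumes det: "det (A :: real^'n^'n) > 0"
  obtains D where "(stretch has_derivative D) (at A)"
proof -
  define P where "P = stretch A"
  note P = polar_stretch(2,3)[OF det, folded P_def]
  obtain c where c: "c > 0" "\<And>x. c * (x \<bullet> x) \<le> x \<bullet> (P *v x)"
    using positive_definite_coercive P(2) by blast
  define S where "S X = P ** X + X ** P" for X
  have linS: "linear S"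
    unfolding S_def linear_iff by (simp add: matrix_mult.add_left matrix_mult.add_right
        matrix_mult.scaleR_left matrix_mult.scaleR_right scaleR_add_right)
  have "X = 0" if "S X = 0" for X
  proof -
    \<comment> \<open>Coercivity of \<open>P\<close> on either side makes \<open>S\<close> coercive,
      hence injective.\<close>
    have "c * (X \<bullet> X) + c * (X \<bullet> X) \<le> X \<bullet> S X"
      unfolding S_def inner_add_right
      by (intro add_mono quadratic_form_mult_left quadratic_form_mult_right P c)
    then have "X \<bullet> X \<le> 0" using c(1) by (simp add: that mult_le_0_iff)
    then show "X = 0" by (metis inner_eq_zero_iff inner_ge_zero order_antisym)
  qed
  then have "inj S" using linS by (simp add: linear_injective_0)
  then obtain T where T: "linear T" "T \<circ> S = id"
    using linear_injective_left_inverse[OF linS] by blast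
  have TS: "T (S X) = X" for X
    using T(2) by (metis comp_apply id_apply)
  have blT: "bounded_linear T" using T(1) by (simp add: linear_linear)
  obtain K where K: "K \<ge> 0" "\<And>X. norm (T X) \<le> norm X * K"
    using bounded_linear.nonneg_bounded[OF blT] by blast
  define M where "M B = transpose B ** B" for B :: "real^'n^'n"
  have M: "(M has_derivative (\<lambda>B. transpose A ** B + transpose B ** A)) (at A)"
    unfolding M_def
    by (intro matrix_mult.FDERIV bounded_linear.has_derivative[OF bounded_linear_transpose] has_derivative_ident)
  obtain C where C: "C \<ge> 0" "\<forall>\<^sub>F B in nhds A. norm (M B - M A) \<le> C * norm (B - A)"
    using has_derivative_eventually_Lipschitz[OF M] by blast
  have "((\<lambda>B. P + T (M B - M A)) has_derivative (\<lambda>B. 0 + T (transpose A ** B + transpose B ** A - 0))) (at A)"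
    by (intro has_derivative_add has_derivative_const bounded_linear.has_derivative[OF blT]
        has_derivative_diff M)
  \<comment> \<open>\<open>C / c\<close> bounds \<open>stretch B - P\<close> relative to
    \<open>B - A\<close>: \<open>C\<close> comes from \<open>M\<close> and \<open>1 / c\<close> from
    the square root. It enters squared through \<open>X ** X\<close>, and \<open>K\<close> bounds
    \<open>T\<close>.\<close>
  moreover have "\<forall>\<^sub>F B in nhds A. norm (stretch B - (P + T (M B - M A))) \<le> ((C / c)\<^sup>2 * K) * (norm (B - A))\<^sup>2"
    using C(2) eventually_det_pos[OF det]
  proof eventually_elim
    case (elim B)
    define X where "X = stretch B - P"
    note B = polar_stretch(2,3)[OF elim(2)]
    have sq: "M B - M A = stretch B ** stretch B - P ** P"
      using polar_stretch(5)[OF elim(2)] polar_stretch(5)[OF det] by (simp add: M_def P_def)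
    have "c * norm X \<le> C * norm (B - A)"
      using square_root_Lipschitz[OF P(1) c(2) B] elim(1) by (simp add: sq X_def)
    then have nX: "norm X \<le> C / c * norm (B - A)"
      using c(1) by (simp add: field_simps)
    have "stretch B = P + X" by (simp add: X_def)
    then have "M B - M A = S X + X ** X"
      unfolding sq by (simp add: S_def matrix_mult.add_left matrix_mult.add_right)
    then have "stretch B - (P + T (M B - M A)) = - T (X ** X)"
      by (simp add: linear_add[OF T(1)] TS X_def)
    then have "norm (stretch B - (P + T (M B - M A))) \<le> norm (X ** X) * K"
      using K(2)[of "X ** X"] by simp
    also have "\<dots> \<le> (norm X * norm X) * K"
      by (intro mult_right_mono norm_matrix_mult_le K)
    also have "\<dots> \<le> ((C / c * norm (B - A)) * (C / c * norm (B - A))) * K"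
      using nX K(1) C(1) c(1) by (intro mult_right_mono mult_mono) auto
    finally show ?case by (simp add: power2_eq_square mult_ac)
  qed
  ultimately show thesis
    by (rule that[OF has_derivative_quadratic_remainder])
qed

text \<open>The identity \<open>(polar B - U) ** P = (B - A) - polar B ** (stretch B - P)\<close>
  calls only for the fixed inverse \<open>R\<close> of \<open>P\<close>, not for that of
  \<open>stretch B\<close>. Replacing \<open>polar B\<close> by \<open>U\<close> on the right costs
  a product of two small factors, which is the quadratic error.\<close>

lemma polar_differentiable:
  assumes det: "det (A :: real^'n^'n) > 0"
  obtains D where "(polar has_derivative D) (at A)"
proof -
  define P where "P = stretch A"
  define U where "U = polar A"
  note A = polar_stretch[OF det, folded P_def U_def]
  obtain R where R: "P ** R = mat 1"
    using positive_definite_invertible[OF A(3)] by (metis invertible_def invertible_det_nz)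
  obtain D where D: "(stretch has_derivative D) (at A)"
    using stretch_differentiable[OF det] .
  obtain C where C: "C \<ge> 0" "\<forall>\<^sub>F B in nhds A. norm (stretch B - P) \<le> C * norm (B - A)"
    using has_derivative_eventually_Lipschitz[OF D] unfolding P_def by blast
  define n where "n = sqrt (real CARD('n))"
  have n: "n \<ge> 0" by (simp add: n_def)
  have "((\<lambda>B. U + (B - A) ** R - U ** (stretch B - P) ** R) has_derivative
      (\<lambda>B. 0 + (B - 0) ** R - U ** (D B - 0) ** R)) (at A)"
    by (intro has_derivative_add has_derivative_diff has_derivative_const has_derivative_ident D
        bounded_linear.has_derivative[OF matrix_mult.bounded_linear_left]
        bounded_linear.has_derivative[OF matrix_mult.bounded_linear_right])
  moreover have "\<forall>\<^sub>F B in nhds A. norm (polar B - (U + (B - A) ** R - U ** (stretch B - P) ** R))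
      \<le> ((1 + n * C) * norm R * C * norm R) * (norm (B - A))\<^sup>2"
    using C(2) eventually_det_pos[OF det]
  proof eventually_elim
    case (elim B)
    note B = polar_stretch[OF elim(2)]
    have nV: "norm (polar B) = n"
      using B(1) by (simp add: n_def SO_def rotation_matrix_def norm_orthogonal_matrix)
    have "(polar B - U) ** P = (B - A) - polar B ** (stretch B - P)"
      using A(4) B(4) by (simp add: matrix_mult.diff_left matrix_mult.diff_right)
    then have "(polar B - U) ** P ** R = ((B - A) - polar B ** (stretch B - P)) ** R"
      by simp
    then have V: "polar B - U = ((B - A) - polar B ** (stretch B - P)) ** R"
      by (simp add: R flip: matrix_mul_assoc)
    have "norm (polar B - U) \<le> norm ((B - A) - polar B ** (stretch B - P)) * norm R"
      unfolding V by (rule norm_matrix_mult_le)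
    also have "norm ((B - A) - polar B ** (stretch B - P)) \<le> norm (B - A) + norm (polar B ** (stretch B - P))"
      by (rule norm_triangle_ineq4)
    also have "norm (polar B ** (stretch B - P)) \<le> n * norm (stretch B - P)"
      using norm_matrix_mult_le[of "polar B" "stretch B - P"] by (simp add: nV)
    also have "\<dots> \<le> n * (C * norm (B - A))"
      by (rule mult_left_mono[OF elim(1) n])
    finally have nVU: "norm (polar B - U) \<le> (1 + n * C) * norm R * norm (B - A)"
      by (simp add: mult_right_mono algebra_simps)
    have "polar B - (U + (B - A) ** R - U ** (stretch B - P) ** R)
        = - ((polar B - U) ** (stretch B - P) ** R)"
      using V by (simp add: matrix_mult.diff_left matrix_mult.add_left algebra_simps)
    then have "norm (polar B - (U + (B - A) ** R - U ** (stretch B - P) ** R))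
        = norm ((polar B - U) ** (stretch B - P) ** R)"
      by (simp only: norm_minus_cancel)
    also have "\<dots> \<le> norm (polar B - U) * norm (stretch B - P) * norm R"
      by (meson mult_right_mono norm_ge_zero norm_matrix_mult_le order_trans)
    also have "\<dots> \<le> ((1 + n * C) * norm R * norm (B - A)) * (C * norm (B - A)) * norm R"
      using nVU elim(1) C(1) n by (intro mult_right_mono mult_mono) auto
    finally show ?case by (simp add: power2_eq_square mult_ac)
  qed
  ultimately show thesis
    by (rule that[OF has_derivative_quadratic_remainder])
qed

section \<open>The left-trivialized tangent map of the polar projection\<close>

lemma transpose_skew_mat [simp]: "transpose (skew_mat X) = - skew_mat X"
  using skew_mat[of X] by simp

text \<open>Differentiating \<open>transpose (polar B) ** polar B = mat 1\<close>, valid near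
  \<open>A\<close>, shows that \<open>transpose U ** E B\<close> is skew-symmetric.\<close>

lemma polar_has_derivative_skew:
  assumes det: "det (A :: real^'n^'n) > 0"
  obtains D where "linear D" "(polar has_derivative (\<lambda>B. polar A ** skew_mat (D B))) (at A)"
proof -
  define U where "U = polar A"
  have U: "U \<in> SO" using polar_stretch(1)[OF det] by (simp add: U_def)
  obtain E where E: "(polar has_derivative E) (at A)"
    using polar_differentiable[OF det] .
  have "((\<lambda>B. transpose (polar B) ** polar B) has_derivative
      (\<lambda>B. transpose U ** E B + transpose (E B) ** U)) (at A)"
    unfolding U_def
    by (intro matrix_mult.FDERIV bounded_linear.has_derivative[OF bounded_linear_transpose] E)
  moreover have "\<forall>\<^sub>F B in nhds A. transpose (polar B) ** polar B = mat 1"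
    using eventually_det_pos[OF det] by eventually_elim (simp add: SO_orthogonal polar_stretch)
  then have "((\<lambda>B. transpose (polar B) ** polar B) has_derivative (\<lambda>B. 0)) (at A)"
    by (intro has_derivative_transform_eventually[OF has_derivative_const[of "mat 1"]])
      (auto dest: eventually_nhds_x_imp_x simp: eventually_at_filter elim: eventually_mono)
  ultimately have "(\<lambda>B. transpose U ** E B + transpose (E B) ** U) = (\<lambda>B. 0)"
    by (rule has_derivative_unique)
  then have "transpose U ** E B + transpose (E B) ** U = 0" for B
    by (rule fun_cong)
  then have skew: "transpose (transpose U ** E B) = - (transpose U ** E B)" for B
    by (simp add: matrix_transpose_mul add_eq_0_iff)
  define D where "D B = Abs_skew (transpose U ** E B)" for B
  have D: "skew_mat (D B) = transpose U ** E B" for B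
    unfolding D_def using skew by (simp add: Abs_skew_inverse)
  have UD: "U ** skew_mat (D B) = E B" for B
    by (simp add: D matrix_mul_assoc SO_orthogonal[OF U])
  have "linear E" using E has_derivative_linear by blast
  then have "linear D"
    by (simp add: linear_iff skew_eq_iff D plus_skew.rep_eq scaleR_skew.rep_eq
        matrix_mult.add_right matrix_mult.scaleR_right)
  moreover have "(polar has_derivative (\<lambda>B. polar A ** skew_mat (D B))) (at A)"
    using E by (simp add: UD flip: U_def)
  ultimately show thesis by (rule that)
qed

lemma dpolar_derivative:
  assumes det: "det (A :: real^'n^'n) > 0"
  shows "linear (dpolar A)" "(polar has_derivative (\<lambda>B. polar A ** skew_mat (dpolar A B))) (at A)"
proof -
  obtain D where D: "linear D" "(polar has_derivative (\<lambda>B. polar A ** skew_mat (D B))) (at A)"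
    using polar_has_derivative_skew[OF det] .
  have chain: "((\<lambda>t. polar (\<alpha> t)) has_vector_derivative polar A ** skew_mat (D B)) (at 0)"
    if "\<alpha> 0 = A" "(\<alpha> has_vector_derivative B) (at 0)" for \<alpha> B
    using vector_derivative_diff_chain_within[of \<alpha> B 0 UNIV polar, OF that(2)]
      has_derivative_at_withinI[OF D(2), of "range \<alpha>"] that(1)
    by (simp add: o_def)
  have "dpolar A B = D B" for B
    unfolding dpolar_def
  proof (rule the_equality)
    fix X
    assume X: "\<forall>\<alpha>. \<alpha> 0 = A \<and> (\<alpha> has_vector_derivative B) (at 0) \<longrightarrow>
      ((\<lambda>t. polar (\<alpha> t)) has_vector_derivative polar A ** skew_mat X) (at 0)"
    define \<alpha> where "\<alpha> t = A + t *\<^sub>R B" for t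
    have \<alpha>: "\<alpha> 0 = A" "(\<alpha> has_vector_derivative B) (at 0)"
      unfolding \<alpha>_def by (auto intro!: derivative_eq_intros)
    have "polar A ** skew_mat X = polar A ** skew_mat (D B)"
      using X \<alpha> chain[OF \<alpha>] vector_derivative_unique_at by blast
    then have "transpose (polar A) ** (polar A ** skew_mat X)
        = transpose (polar A) ** (polar A ** skew_mat (D B))"
      by simp
    then show "X = D B"
      by (simp add: matrix_mul_assoc SO_orthogonal polar_stretch[OF det] skew_eq_iff)
  qed (use chain in auto)
  then have "dpolar A = D" by auto
  then show "linear (dpolar A)" "(polar has_derivative (\<lambda>B. polar A ** skew_mat (dpolar A B))) (at A)"
    using D by auto
qed

section \<open>Adjoints of maps between skew-symmetric matrices\<close>

lemma linear_Asym: "linear Asym"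
  by (simp add: linear_iff skew_eq_iff Asym.rep_eq plus_skew.rep_eq scaleR_skew.rep_eq
      transpose_simps algebra_simps)

text \<open>The half in the inner product absorbs the two equal contributions of \<open>M\<close>
  and its transpose, so \<open>Asym\<close> is the adjoint of the inclusion
  \<open>skew_mat\<close>.\<close>

lemma inner_Asym: "X \<bullet> Asym M = skew_mat X \<bullet> M"
proof -
  have "skew_mat X \<bullet> transpose M = - (skew_mat X \<bullet> M)"
    by (metis inner_minus_left inner_transpose_transpose transpose_skew_mat transpose_transpose)
  then show ?thesis
    by (simp add: inner_skew_def trace_mult_transpose Asym.rep_eq inner_diff_right)
qed

lemma Asym_skew_mat: "Asym (skew_mat X) = 2 *\<^sub>R X"
  unfolding scaleR_2 by (simp add: skew_eq_iff Asym.rep_eq plus_skew.rep_eq)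

text \<open>The type \<open>'n skew\<close> cannot be made an instance of \<open>euclidean_space\<close>, because that class
  excludes the zero space arising for one-element \<open>'n\<close>.\<close>

lemma skew_riesz:
  fixes f :: "'n::finite skew \<Rightarrow> real"
  assumes f: "linear f"
  obtains G where "\<And>X. f X = X \<bullet> G"
proof -
  \<comment> \<open>The elements \<open>Asym b /\<^sub>R 2\<close> only span the skew-symmetric
    matrices, but every \<open>X\<close> has an explicit expansion in them because
    \<open>Asym (skew_mat X) = 2 *\<^sub>R X\<close>.\<close>
  define M where "M = (\<Sum>b\<in>Basis. f (Asym b /\<^sub>R 2) *\<^sub>R b)"
  have "f X = X \<bullet> Asym M" for X
  proof -
    have "X = Asym (\<Sum>b\<in>Basis. (skew_mat X \<bullet> b) *\<^sub>R b) /\<^sub>R 2"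
      by (simp add: euclidean_representation Asym_skew_mat)
    also have "\<dots> = (\<Sum>b\<in>Basis. (skew_mat X \<bullet> b) *\<^sub>R (Asym b /\<^sub>R 2))"
      by (simp add: linear_sum[OF linear_Asym] linear_scale[OF linear_Asym] scaleR_sum_right
          mult.commute)
    finally have "f X = f (\<Sum>b\<in>Basis. (skew_mat X \<bullet> b) *\<^sub>R (Asym b /\<^sub>R 2))"
      by (rule arg_cong)
    also have "\<dots> = skew_mat X \<bullet> M"
      by (simp add: linear_sum[OF f] linear_scale[OF f] M_def inner_sum_right mult.commute)
    finally show ?thesis by (simp add: inner_Asym)
  qed
  then show thesis by (rule that)
qed

text \<open>The Riesz representation supplies a witness for the choice in \<open>adjoint\<close>;
  this is where linearity enters.\<close>

lemma skew_adjoint_works: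
  fixes f :: "'n::finite skew \<Rightarrow> 'm::finite skew"
  assumes f: "linear f"
  shows "f X \<bullet> Y = X \<bullet> adjoint f Y"
proof -
  have "\<exists>G. \<forall>X. f X \<bullet> Y = X \<bullet> G" for Y
  proof -
    have "linear (\<lambda>X. f X \<bullet> Y)"
      using f by (simp add: linear_iff inner_add_left)
    then show ?thesis by (rule skew_riesz) blast
  qed
  then have "\<exists>f'. \<forall>X Y. f X \<bullet> Y = X \<bullet> f' Y" by metis
  then show ?thesis
    unfolding adjoint_def by (rule someI2_ex) blast
qed

lemma skew_adjoint_minus:
  fixes f :: "'n::finite skew \<Rightarrow> 'm::finite skew"
  assumes "linear f"
  shows "adjoint f (- Y) = - adjoint f Y"
proof -
  have "X \<bullet> adjoint f (- Y) = X \<bullet> - adjoint f Y" for X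
    using skew_adjoint_works[OF assms, of X] by (metis inner_minus_right)
  then show ?thesis using vector_eq_ldot by blast
qed

section \<open>Linearity of the maps of the integrator\<close>

lemma linear_inv:
  assumes "linear f" "bij f"
  shows "linear (inv f)"
proof -
  have f: "f (inv f x) = x" "inv f (f z) = z" for x z
    using assms(2) by (simp_all add: bij_is_surj surj_f_inv_f bij_is_inj)
  have "inv f (x + y) = inv f (f (inv f x + inv f y))" for x y
    by (simp add: linear_add[OF assms(1)] f(1))
  moreover have "inv f (c *\<^sub>R x) = inv f (f (c *\<^sub>R inv f x))" for c x
    by (simp add: linear_scale[OF assms(1)] f(1))
  ultimately show ?thesis by (simp add: linear_iff f(2))
qed

lemma linear_phi_tilde:
  fixes A :: "'b::finite \<Rightarrow> real^'a^'a"
  assumes "\<forall>i. det (A i) > 0"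
  shows "linear (phi_tilde h a A U \<Omega>)"
proof -
  define T where "T i X = h *\<^sub>R (\<Sum>j\<in>UNIV. a i j *\<^sub>R (U j ** skew_mat (X $ j) ** skew_mat (\<Omega> j)))"
    for i and X :: "('a skew)^'b"
  have "linear (\<lambda>X. X $ i - dpolar (A i) (T i X))" for i
  proof (rule linear_compose_sub)
    show "linear (\<lambda>X :: ('a skew)^'b. X $ i)" by (simp add: linear_iff)
    have "linear (T i)"
      unfolding T_def linear_iff
      by (simp add: plus_skew.rep_eq scaleR_skew.rep_eq matrix_mult.add_left matrix_mult.add_right
          matrix_mult.scaleR_left matrix_mult.scaleR_right scaleR_add_right sum.distrib scaleR_sum_right)
        (simp add: mult_ac)
    from linear_compose[OF this dpolar_derivative(1)]
    show "linear (\<lambda>X. dpolar (A i) (T i X))"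
      using assms by (simp add: o_def)
  qed
  moreover have "phi_tilde h a A U \<Omega> X $ i = X $ i - dpolar (A i) (T i X)" for X i
    by (simp add: phi_tilde_def T_def)
  ultimately show ?thesis
    by (simp add: linear_iff vec_eq_iff)
qed

lemma linear_psi_tilde:
  assumes "\<forall>i. det (A i) > 0"
  shows "linear (psi_tilde a A U k)"
proof -
  note D = dpolar_derivative(1)[OF assms[rule_format]]
  show ?thesis
    by (simp add: linear_iff psi_tilde_def vec_eq_iff plus_skew.rep_eq scaleR_skew.rep_eq
        matrix_mult.add_right matrix_mult.scaleR_right scaleR_add_right linear_add[OF D]
        linear_scale[OF D] mult_ac)
qed

lemma linear_varphi_tilde:
  assumes "\<forall>i. det (A i) > 0"
  shows "linear (varphi_tilde A g0)"
proof -
  note D = dpolar_derivative(1)[OF assms[rule_format]]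
  show ?thesis
    by (simp add: linear_iff varphi_tilde_def vec_eq_iff plus_skew.rep_eq scaleR_skew.rep_eq
        matrix_mult.add_right matrix_mult.scaleR_right linear_add[OF D] linear_scale[OF D])
qed

lemma linear_pi_tilde: "linear (pi_tilde i)"
  by (simp add: linear_iff pi_tilde_def)

section \<open>The Legendre transform\<close>

lemma grad_skew_eqI:
  assumes "GDERIV (\<lambda>Y. F (V, Y)) X :> G"
  shows "grad_skew F V X = G"
  unfolding grad_skew_def
proof (rule the_equality)
  show "GDERIV (\<lambda>Y. F (V, Y)) X :> G" by (rule assms)
  fix G' assume "GDERIV (\<lambda>Y. F (V, Y)) X :> G'"
  then have "(\<lambda>v. v \<bullet> G') = (\<lambda>v. v \<bullet> G)"
    using assms unfolding gderiv_def by (rule has_derivative_unique)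
  then show "G' = G" by (metis vector_eq_ldot)
qed

section \<open>Curves in the rotation group with prescribed velocity\<close>

lemma SO_det: "V \<in> SO \<Longrightarrow> det V = 1"
  by (simp add: SO_def rotation_matrix_def)

lemma polar_SO:
  assumes "V \<in> SO"
  shows "polar V = V" "stretch V = mat 1"
proof -
  have "positive_definite (mat 1 :: real^'n^'n)"
    by (simp add: positive_definite_def)
  then show "polar V = V"
    using polar_eqI[OF assms, of "mat 1"] by simp
  then show "stretch V = mat 1"
    by (simp add: stretch_def SO_orthogonal[OF assms])
qed

text \<open>Differentiating \<open>B = polar B ** stretch B\<close> at a rotation \<open>V\<close>,
  where \<open>stretch V = mat 1\<close>, splits \<open>transpose V ** B\<close> into its symmetric
  and skew parts, and \<open>dpolar\<close> is the skew one.\<close>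

lemma dpolar_SO:
  assumes V: "V \<in> SO"
  shows "dpolar V (V ** skew_mat \<eta>) = \<eta>"
proof -
  have det: "det V > 0" using SO_det[OF V] by simp
  note ev = eventually_det_pos[OF det]
  obtain D where D: "(stretch has_derivative D) (at V)"
    using stretch_differentiable[OF det] .
  have "((\<lambda>B. transpose (stretch B)) has_derivative (\<lambda>B. transpose (D B))) (at V)"
    by (rule bounded_linear.has_derivative[OF bounded_linear_transpose D])
  moreover have "((\<lambda>B. transpose (stretch B)) has_derivative D) (at V)"
    using ev by (intro has_derivative_transform_eventually[OF D])
      (auto dest: eventually_nhds_x_imp_x simp: eventually_at_filter polar_stretch elim: eventually_mono)
  ultimately have sym: "transpose (D B) = D B" for B
    using has_derivative_unique by metis
  define E where "E B = skew_mat (dpolar V B)" for B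
  have "((\<lambda>B. polar B ** stretch B) has_derivative (\<lambda>B. polar V ** D B + (polar V ** E B) ** stretch V)) (at V)"
    using matrix_mult.FDERIV[OF dpolar_derivative(2)[OF det] D] by (simp add: E_def)
  moreover have "((\<lambda>B. polar B ** stretch B) has_derivative (\<lambda>B. B)) (at V)"
    using ev by (intro has_derivative_transform_eventually[OF has_derivative_ident])
      (auto dest: eventually_nhds_x_imp_x simp: eventually_at_filter polar_stretch elim: eventually_mono)
  ultimately have "(\<lambda>B. polar V ** D B + (polar V ** E B) ** stretch V) = (\<lambda>B. B)"
    by (rule has_derivative_unique)
  then have eq: "V ** D B + V ** E B = B" for B
    by (simp add: polar_SO[OF V] fun_eq_iff)
  define B where "B = V ** skew_mat \<eta>"
  have "transpose V ** (V ** (D B + E B)) = transpose V ** (V ** skew_mat \<eta>)"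
    using eq[of B] by (simp add: matrix_mult.add_right B_def)
  then have DE: "D B + E B = skew_mat \<eta>"
    by (simp add: matrix_mul_assoc SO_orthogonal[OF V])
  from arg_cong[OF DE, of transpose] have DE': "D B - E B = - skew_mat \<eta>"
    by (simp add: transpose_simps sym E_def)
  have "2 *\<^sub>R E B = (D B + E B) - (D B - E B)"
    by (simp add: scaleR_2)
  also have "\<dots> = 2 *\<^sub>R skew_mat \<eta>"
    unfolding DE DE' by (simp add: scaleR_2)
  finally have "E B = skew_mat \<eta>" by simp
  then show ?thesis by (simp add: E_def B_def skew_eq_iff)
qed

text \<open>The straight line with the given velocity is projected back to \<open>SO\<close>; by
  \<open>dpolar_SO\<close> this leaves the velocity unchanged.\<close>

lemma SO_curve:
  assumes V: "V \<in> SO"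
  obtains \<gamma> where "\<And>t. \<gamma> t \<in> SO" "\<gamma> 0 = V" "(\<gamma> has_vector_derivative V ** skew_mat \<eta>) (at (0::real))"
proof -
  define \<alpha> where "\<alpha> t = V + t *\<^sub>R (V ** skew_mat \<eta>)" for t :: real
  \<comment> \<open>The fallback \<open>V\<close> ensures membership in \<open>SO\<close> for every
    \<open>t\<close>, as \<open>grad_group\<close> demands, while positivity of the determinant has
    to be known only near 0.\<close>
  define \<gamma> where "\<gamma> t = (if det (\<alpha> t) > 0 then polar (\<alpha> t) else V)" for t
  have det: "det V > 0" using SO_det[OF V] by simp
  have \<alpha>0: "\<alpha> 0 = V" by (simp add: \<alpha>_def)
  have \<alpha>: "(\<alpha> has_vector_derivative V ** skew_mat \<eta>) (at 0)"
    unfolding \<alpha>_def by (auto intro!: derivative_eq_intros)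
  have "((\<lambda>t. polar (\<alpha> t)) has_vector_derivative polar V ** skew_mat (dpolar V (V ** skew_mat \<eta>))) (at 0)"
    using vector_derivative_diff_chain_within[OF \<alpha>, of polar]
      has_derivative_at_withinI[OF dpolar_derivative(2)[OF det], of "range \<alpha>"]
    by (simp add: o_def \<alpha>0)
  then have "((\<lambda>t. polar (\<alpha> t)) has_vector_derivative V ** skew_mat \<eta>) (at 0)"
    by (simp add: polar_SO[OF V] dpolar_SO[OF V])
  moreover have "\<forall>\<^sub>F t in at 0. det (\<alpha> t) > 0"
  proof -
    have "(\<alpha> \<longlongrightarrow> V) (at 0)"
      using has_vector_derivative_continuous[OF \<alpha>] by (simp add: continuous_within \<alpha>0)
    then show ?thesis
      using eventually_det_pos[OF det] unfolding filterlim_iff by blast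
  qed
  then have "\<forall>\<^sub>F t in at 0. polar (\<alpha> t) = \<gamma> t"
    by eventually_elim (simp add: \<gamma>_def)
  ultimately have "(\<gamma> has_vector_derivative V ** skew_mat \<eta>) (at 0)"
    unfolding has_vector_derivative_def
    by (rule has_derivative_transform_eventually) (simp_all add: \<gamma>_def \<alpha>0 det)
  moreover have "\<gamma> t \<in> SO" for t
    by (simp add: \<gamma>_def V polar_stretch)
  moreover have "\<gamma> 0 = V"
    by (simp add: \<gamma>_def \<alpha>0 polar_SO[OF V])
  ultimately show thesis using that by blast
qed

lemma grad_group_eqI:
  assumes V: "V \<in> SO"
    and G: "\<And>\<gamma> \<eta>. (\<And>t. \<gamma> t \<in> SO) \<Longrightarrow> \<gamma> 0 = V \<Longrightarrow> (\<gamma> has_vector_derivative V ** skew_mat \<eta>) (at 0)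
      \<Longrightarrow> ((\<lambda>t. F (\<gamma> t, X)) has_real_derivative G \<bullet> \<eta>) (at 0)"
  shows "grad_group F V X = G"
  unfolding grad_group_def
proof (rule the_equality)
  fix G'
  assume G': "\<forall>\<gamma> \<eta>. (\<forall>t. \<gamma> t \<in> SO) \<and> \<gamma> 0 = V \<and> (\<gamma> has_vector_derivative V ** skew_mat \<eta>) (at 0)
      \<longrightarrow> ((\<lambda>t. F (\<gamma> t, X)) has_real_derivative G' \<bullet> \<eta>) (at 0)"
  have "G' \<bullet> \<eta> = G \<bullet> \<eta>" for \<eta>
  proof -
    obtain \<gamma> where \<gamma>: "\<And>t. \<gamma> t \<in> SO" "\<gamma> 0 = V" "(\<gamma> has_vector_derivative V ** skew_mat \<eta>) (at 0)"
      using SO_curve[OF V] by blast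
    show ?thesis
      using G[OF \<gamma>] G'[rule_format, of \<gamma> \<eta>] \<gamma> DERIV_unique by blast
  qed
  then show "G' = G" by (metis vector_eq_rdot)
qed (use G in blast)

text \<open>\<open>SO \<times> UNIV\<close> is not open, so a map smooth on it is differentiated
  through a local extension. The map \<open>f'\<close> depends on the extension chosen and is used
  only along curves inside \<open>M\<close>.\<close>

definition has_tangent_map ::
  "('a::real_normed_vector \<Rightarrow> 'b::real_normed_vector) \<Rightarrow> ('a \<Rightarrow> 'b) \<Rightarrow> 'a \<Rightarrow> 'a set \<Rightarrow> bool" where
  "has_tangent_map f f' x M \<longleftrightarrow>
     (\<exists>W g. open W \<and> x \<in> W \<and> (\<forall>y\<in>M \<inter> W. g y = f y) \<and> (g has_derivative f') (at x))"

lemma smooth_map_on_has_tangent_map: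
  assumes "smooth_map_on M f" "x \<in> M"
  obtains f' where "has_tangent_map f f' x M"
proof -
  obtain W g where g: "open W" "x \<in> W" "\<forall>k. Ck_on k g W" "\<forall>y\<in>M \<inter> W. g y = f y"
    using assms unfolding smooth_map_on_def by blast
  have "Ck_on (Suc 0) g W" using g(3) by blast
  then have "g differentiable (at x)" using g(2) by simp
  then obtain f' where "(g has_derivative f') (at x)"
    unfolding differentiable_def by blast
  then show thesis using g that unfolding has_tangent_map_def by blast
qed

lemma has_tangent_map_linear: "has_tangent_map f f' x M \<Longrightarrow> linear f'"
  unfolding has_tangent_map_def using has_derivative_linear by blast

text \<open>As long as \<open>c\<close> stays in \<open>M\<close>, the extension and
  \<open>f\<close> agree along \<open>c\<close> near \<open>z\<close>.\<close>

lemma has_tangent_map_chain: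
  assumes f: "has_tangent_map f f' (c z) M" and c: "(c has_derivative c') (at z)"
    and M: "\<And>t. c t \<in> M"
  shows "((\<lambda>t. f (c t)) has_derivative (\<lambda>v. f' (c' v))) (at z)"
proof -
  obtain W g where g: "open W" "c z \<in> W" "\<forall>y\<in>M \<inter> W. g y = f y" "(g has_derivative f') (at (c z))"
    using f unfolding has_tangent_map_def by blast
  have "((\<lambda>t. g (c t)) has_derivative (\<lambda>v. f' (c' v))) (at z)"
    by (rule has_derivative_compose[OF c g(4)])
  moreover have "\<forall>\<^sub>F t in at z. c t \<in> W"
    using has_derivative_continuous[OF c] g(1,2) unfolding continuous_within
    by (rule topological_tendstoD)
  then have "\<forall>\<^sub>F t in at z. g (c t) = f (c t)"
    by eventually_elim (use M g(3) in auto)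
  ultimately show ?thesis
    by (rule has_derivative_transform_eventually) (use M g(2,3) in auto)
qed

lemma has_tangent_map_chain_vector:
  fixes c :: "real \<Rightarrow> 'a::real_normed_vector"
  assumes f: "has_tangent_map f f' (c z) M" and c: "(c has_vector_derivative w) (at z)"
    and M: "\<And>t. c t \<in> M"
  shows "((\<lambda>t. f (c t)) has_vector_derivative f' w) (at z)"
  using has_tangent_map_chain[OF f c[unfolded has_vector_derivative_def] M]
  by (simp add: has_vector_derivative_def linear_scale[OF has_tangent_map_linear[OF f]])

text \<open>With \<open>y (U, \<nu>)\<close> the velocity belonging to \<open>\<nu>\<close>,
  \<open>H\<close> is \<open>\<nu> \<bullet> y - L (U, y)\<close>. In any derivative of
  \<open>H\<close> the variation of \<open>y\<close> cancels because the velocity gradient of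
  \<open>L\<close> is the momentum, so \<open>y\<close> need only be differentiable, and the smooth
  inverse in hyperregularity gives that.\<close>

lemma legendre_transform:
  fixes L H :: "(real^'n^'n) \<times> 'n::finite skew \<Rightarrow> real"
  assumes L: "smooth_map_on (SO \<times> UNIV) L" and hyp: "hyperregular L"
    and H: "\<forall>V\<in>SO. \<forall>\<nu>. H (V, \<nu>) = hamiltonian L (V, \<nu>)"
    and V: "V \<in> SO" and \<mu>: "\<mu> = grad_skew L V X"
  shows "grad_skew H V \<mu> = X" "grad_group H V \<mu> = - grad_group L V X"
proof -
  define S :: "((real^'n^'n) \<times> 'n skew) set" where "S = SO \<times> UNIV"
  define F where "F = (\<lambda>(U, X). (U, grad_skew L U X))"
  \<comment> \<open>\<open>F\<close> preserves the group component, so its inverse is determined by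
    the second component.\<close>
  define y where "y p = snd (inv_into S F p)" for p
  have F: "bij_betw F S S" and smooth_inv: "smooth_map_on S (inv_into S F)"
    using hyp by (auto simp: hyperregular_def diffeomorphism_between_def S_def F_def)
  have F_inv: "F (inv_into S F p) = p" "inv_into S F p \<in> S" if "p \<in> S" for p
    using F that by (auto simp: bij_betw_def f_inv_into_f inv_into_into)
  have inv_eq: "inv_into S F (U, \<nu>) = (U, y (U, \<nu>))" and y: "grad_skew L U (y (U, \<nu>)) = \<nu>"
    if "U \<in> SO" for U \<nu>
  proof -
    have "F (inv_into S F (U, \<nu>)) = (U, \<nu>)"
      using F_inv(1) that by (simp add: S_def)
    then show "inv_into S F (U, \<nu>) = (U, y (U, \<nu>))" "grad_skew L U (y (U, \<nu>)) = \<nu>"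
      by (auto simp: F_def y_def prod_eq_iff split: prod.splits)
  qed
  have y_unique: "Y = y (U, \<nu>)" if "U \<in> SO" "grad_skew L U Y = \<nu>" for U Y \<nu>
  proof -
    have "F (U, Y) = F (U, y (U, \<nu>))"
      using that by (simp add: F_def y)
    then show ?thesis
      using F that(1) by (auto simp: bij_betw_def inj_on_def S_def)
  qed
  have H_eq: "H (U, \<nu>) = \<nu> \<bullet> y (U, \<nu>) - L (U, y (U, \<nu>))" if "U \<in> SO" for U \<nu>
  proof -
    have "(THE X. grad_skew L U X = \<nu>) = y (U, \<nu>)"
      using y y_unique that by blast
    then show ?thesis using H that by (simp add: hamiltonian_def Let_def)
  qed
  have yV: "y (V, \<mu>) = X" using y_unique[OF V] \<mu> by simp
  obtain L' where L': "has_tangent_map L L' (V, X) S"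
    using smooth_map_on_has_tangent_map[OF L] V unfolding S_def by blast
  obtain I' where I': "has_tangent_map (inv_into S F) I' (V, \<mu>) S"
    using smooth_map_on_has_tangent_map[OF smooth_inv] V unfolding S_def by blast
  note linL = has_tangent_map_linear[OF L']
  \<comment> \<open>In the velocity directions the derivative of the chosen extension is intrinsic:
    it is pairing with the momentum.\<close>
  have L'_snd: "L' (0, \<delta>) = \<delta> \<bullet> \<mu>" for \<delta>
  proof -
    have "linear (\<lambda>\<delta>. L' (0, \<delta>))"
      using linL by (simp add: linear_iff) (metis add_0 add_Pair scaleR_Pair scaleR_zero_right)
    then obtain G where G: "\<And>\<delta>. L' (0, \<delta>) = \<delta> \<bullet> G"
      by (rule skew_riesz) blast
    have "((\<lambda>Y. L (V, Y)) has_derivative (\<lambda>\<delta>. L' (0, \<delta>))) (at X)"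
      by (rule has_tangent_map_chain[where c = "\<lambda>Y. (V, Y)" and c' = "\<lambda>\<delta>. (0, \<delta>)" and M = S])
        (use V L' in \<open>auto simp: S_def intro!: has_derivative_Pair has_derivative_const has_derivative_ident\<close>)
    then have "GDERIV (\<lambda>Y. L (V, Y)) X :> G"
      by (simp add: gderiv_def G)
    then have "\<mu> = G" by (simp add: \<mu> grad_skew_eqI)
    then show ?thesis by (simp add: G)
  qed
  have L'_split: "L' (B, \<delta>) = L' (B, 0) + \<delta> \<bullet> \<mu>" for B \<delta>
    using linear_add[OF linL, of "(B, 0)" "(0, \<delta>)"] by (simp add: L'_snd)
  show "grad_skew H V \<mu> = X"
  proof (rule grad_skew_eqI)
    have "((\<lambda>\<nu>. inv_into S F (V, \<nu>)) has_derivative (\<lambda>\<delta>. I' (0, \<delta>))) (at \<mu>)"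
      by (rule has_tangent_map_chain[where c = "\<lambda>\<nu>. (V, \<nu>)" and c' = "\<lambda>\<delta>. (0, \<delta>)" and M = S])
        (use V I' in \<open>auto simp: S_def intro!: has_derivative_Pair has_derivative_const has_derivative_ident\<close>)
    then have dy: "((\<lambda>\<nu>. y (V, \<nu>)) has_derivative (\<lambda>\<delta>. snd (I' (0, \<delta>)))) (at \<mu>)"
      unfolding y_def by (rule has_derivative_snd)
    have "((\<lambda>\<nu>. L (V, y (V, \<nu>))) has_derivative (\<lambda>\<delta>. L' (0, snd (I' (0, \<delta>))))) (at \<mu>)"
      by (rule has_tangent_map_chain[where c = "\<lambda>\<nu>. (V, y (V, \<nu>))" and f' = L' and M = S
          and c' = "\<lambda>\<delta>. (0, snd (I' (0, \<delta>)))"])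
        (use V L' in \<open>auto simp: S_def yV intro!: has_derivative_Pair has_derivative_const dy\<close>)
    \<comment> \<open>The product rule gives \<delta> paired with \<open>X\<close> plus \<mu> paired
      with the variation of \<open>y\<close>; by \<open>L'_snd\<close> the Lagrangian term cancels
      the latter.\<close>
    from has_derivative_diff[OF has_derivative_inner[OF has_derivative_ident dy] this]
    show "GDERIV (\<lambda>\<nu>. H (V, \<nu>)) \<mu> :> X"
      by (simp add: gderiv_def H_eq[OF V] L'_snd yV inner_commute)
  qed
  have "linear (\<lambda>\<eta>. L' (V ** skew_mat \<eta>, 0))"
    using linear_add[OF linL, of "(_, 0)" "(_, 0)"] linear_scale[OF linL, of _ "(_, 0)"]
    by (simp add: linear_iff plus_skew.rep_eq scaleR_skew.rep_eq matrix_mult.add_right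
        matrix_mult.scaleR_right)
  then obtain G where G: "\<And>\<eta>. L' (V ** skew_mat \<eta>, 0) = \<eta> \<bullet> G"
    by (rule skew_riesz) blast
  have "grad_group L V X = G"
  proof (rule grad_group_eqI[OF V])
    fix \<gamma> \<eta>
    assume \<gamma>: "\<And>t. \<gamma> t \<in> SO" "\<gamma> 0 = V" "(\<gamma> has_vector_derivative V ** skew_mat \<eta>) (at (0::real))"
    have "((\<lambda>t. L (\<gamma> t, X)) has_vector_derivative L' (V ** skew_mat \<eta>, 0)) (at 0)"
      by (rule has_tangent_map_chain_vector[where c = "\<lambda>t. (\<gamma> t, X)" and f' = L' and M = S])
        (use \<gamma> L' in \<open>auto simp: S_def intro!: has_vector_derivative_Pair\<close>)
    then show "((\<lambda>t. L (\<gamma> t, X)) has_real_derivative G \<bullet> \<eta>) (at 0)"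
      by (simp add: G inner_commute has_real_derivative_iff_has_vector_derivative)
  qed
  moreover have "grad_group H V \<mu> = - G"
  proof (rule grad_group_eqI[OF V])
    fix \<gamma> \<eta>
    assume \<gamma>: "\<And>t. \<gamma> t \<in> SO" "\<gamma> 0 = V" "(\<gamma> has_vector_derivative V ** skew_mat \<eta>) (at (0::real))"
    define B where "B = V ** skew_mat \<eta>"
    define \<xi> where "\<xi> = snd (I' (B, 0))"
    have "((\<lambda>t. inv_into S F (\<gamma> t, \<mu>)) has_vector_derivative I' (B, 0)) (at 0)"
      by (rule has_tangent_map_chain_vector[where c = "\<lambda>t. (\<gamma> t, \<mu>)" and f' = I' and M = S])
        (use \<gamma> I' in \<open>auto simp: S_def B_def intro!: has_vector_derivative_Pair\<close>)
    then have dy: "((\<lambda>t. y (\<gamma> t, \<mu>)) has_vector_derivative \<xi>) (at 0)"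
      unfolding y_def \<xi>_def has_vector_derivative_def by (drule_tac has_derivative_snd) simp
    have "((\<lambda>t. L (\<gamma> t, y (\<gamma> t, \<mu>))) has_vector_derivative L' (B, \<xi>)) (at 0)"
      by (rule has_tangent_map_chain_vector[where c = "\<lambda>t. (\<gamma> t, y (\<gamma> t, \<mu>))" and f' = L' and M = S])
        (use \<gamma> L' dy in \<open>auto simp: S_def B_def yV intro!: has_vector_derivative_Pair\<close>)
    moreover have "((\<lambda>t. \<mu> \<bullet> y (\<gamma> t, \<mu>)) has_vector_derivative \<mu> \<bullet> \<xi>) (at 0)"
      by (rule bounded_linear.has_vector_derivative[OF bounded_linear_inner_right dy])
    ultimately have "((\<lambda>t. \<mu> \<bullet> y (\<gamma> t, \<mu>) - L (\<gamma> t, y (\<gamma> t, \<mu>))) has_vector_derivative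
        \<mu> \<bullet> \<xi> - L' (B, \<xi>)) (at 0)"
      by (intro has_vector_derivative_diff)
    \<comment> \<open>Splitting \<open>L'\<close> exposes the same cancellation:
      \<open>\<xi>\<close> drops out and only the group direction remains.\<close>
    moreover have "\<mu> \<bullet> \<xi> - L' (B, \<xi>) = - G \<bullet> \<eta>"
      by (subst L'_split) (simp add: G B_def inner_commute)
    ultimately show "((\<lambda>t. H (\<gamma> t, \<mu>)) has_real_derivative - G \<bullet> \<eta>) (at 0)"
      by (simp add: H_eq[OF \<gamma>(1)] has_real_derivative_iff_has_vector_derivative)
  qed
  ultimately show "grad_group H V \<mu> = - grad_group L V X" by simp
qed

section \<open>Term-by-term equivalence of the two systems\<close>

theorem mainTheorem2:
  fixes h :: real
    and a :: "'s::finite \<Rightarrow> 's \<Rightarrow> real"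
    and b :: "'s \<Rightarrow> real"
    and L H :: "(real^'n^'n) \<times> 'n::finite skew \<Rightarrow> real"
    and g0 g1 G :: "real^'n^'n"
    and U A :: "'s \<Rightarrow> real^'n^'n"
    and \<Omega> \<mu> :: "'s \<Rightarrow> 'n skew"
    and \<Lambda> p0 p1 :: "'n skew"
  assumes "h > 0"
    and "\<forall>i. b i \<noteq> 0"
    and "smooth_map_on (SO \<times> UNIV) L"
    and "hyperregular L"
    and "\<forall>V\<in>SO. \<forall>\<nu>. H (V, \<nu>) = hamiltonian L (V, \<nu>)"
    and "g0 \<in> SO" and "g1 \<in> SO" and "\<forall>i. U i \<in> SO"
    and A: "\<forall>i. A i = g0 + h *\<^sub>R (\<Sum>j\<in>UNIV. a i j *\<^sub>R (U j ** skew_mat (\<Omega> j)))"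
    and G: "G = g0 + h *\<^sub>R (\<Sum>i\<in>UNIV. b i *\<^sub>R (U i ** skew_mat (\<Omega> i)))"
    and "\<forall>i. det (A i) > 0"
    and "det G > 0"
    and "bij (phi_tilde h a A U \<Omega>)"
    and \<mu>: "\<forall>i. \<mu> i = grad_skew L (U i) (\<Omega> i)"
  shows
    "((\<forall>k. 0 = h *\<^sub>R (\<Sum>i\<in>UNIV. b i *\<^sub>R
              adjoint (pi_tilde i \<circ> inv (phi_tilde h a A U \<Omega>) \<circ> psi_tilde a A U k)
                (grad_group L (U i) (\<Omega> i)
                  + Asym (transpose (U i) ** g1 ** skew_mat \<Lambda> ** transpose (skew_mat (\<Omega> i)))))
            + b k *\<^sub>R (grad_skew L (U k) (\<Omega> k) + Asym (transpose (U k) ** g1 ** skew_mat \<Lambda>)))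
      \<and> g1 = polar G
      \<and> (\<forall>i. U i = polar (A i))
      \<and> - p0 = h *\<^sub>R (\<Sum>i\<in>UNIV. b i *\<^sub>R
              adjoint (pi_tilde i \<circ> inv (phi_tilde h a A U \<Omega>) \<circ> varphi_tilde A g0)
                (grad_group L (U i) (\<Omega> i)
                  + Asym (transpose (U i) ** g1 ** skew_mat \<Lambda> ** transpose (skew_mat (\<Omega> i)))))
            + Asym (transpose g0 ** g1 ** skew_mat \<Lambda>)
      \<and> p1 = Asym (transpose g1 ** G ** transpose (skew_mat \<Lambda>)))
     \<longleftrightarrow>
     ((\<forall>k. \<mu> k = - Asym (transpose (U k) ** g1 ** skew_mat \<Lambda>)
            + h *\<^sub>R (\<Sum>i\<in>UNIV. (b i / b k) *\<^sub>R
              adjoint (pi_tilde i \<circ> inv (phi_tilde h a A U \<Omega>) \<circ> psi_tilde a A U k)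
                (grad_group H (U i) (\<mu> i)
                  - Asym (transpose (U i) ** g1 ** skew_mat \<Lambda> ** transpose (skew_mat (\<Omega> i))))))
      \<and> g1 = polar G
      \<and> (\<forall>i. U i = polar (A i))
      \<and> Asym (transpose g0 ** g1 ** skew_mat \<Lambda>) = - p0
            + h *\<^sub>R (\<Sum>i\<in>UNIV. b i *\<^sub>R
              adjoint (pi_tilde i \<circ> inv (phi_tilde h a A U \<Omega>) \<circ> varphi_tilde A g0)
                (grad_group H (U i) (\<mu> i)
                  - Asym (transpose (U i) ** g1 ** skew_mat \<Lambda> ** transpose (skew_mat (\<Omega> i)))))
      \<and> p1 = Asym (transpose g1 ** G ** transpose (skew_mat \<Lambda>))
      \<and> (\<forall>i. \<Omega> i = grad_skew H (U i) (\<mu> i)))"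
proof -
  \<comment> \<open>The first identity is the last Hamiltonian equation, which therefore holds
    automatically once \<open>\<mu>\<close> is given by the Legendre transform.\<close>
  have grad_H: "grad_skew H (U i) (\<mu> i) = \<Omega> i"
      "grad_group H (U i) (\<mu> i) = - grad_group L (U i) (\<Omega> i)" for i
    using legendre_transform[of L H "U i" "\<mu> i" "\<Omega> i"] assms by blast+
  define R where "R i = grad_group L (U i) (\<Omega> i)
    + Asym (transpose (U i) ** g1 ** skew_mat \<Lambda> ** transpose (skew_mat (\<Omega> i)))" for i
  have R: "grad_group H (U i) (\<mu> i)
    - Asym (transpose (U i) ** g1 ** skew_mat \<Lambda> ** transpose (skew_mat (\<Omega> i))) = - R i" for i
    by (simp add: R_def grad_H)
  note det = \<open>\<forall>i. det (A i) > 0\<close>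
  have lin: "linear (pi_tilde i \<circ> inv (phi_tilde h a A U \<Omega>))" for i
    by (intro linear_compose linear_inv linear_phi_tilde linear_pi_tilde det
        \<open>bij (phi_tilde h a A U \<Omega>)\<close>)
  note adj = skew_adjoint_minus[OF linear_compose[OF linear_psi_tilde[OF det] lin]]
    skew_adjoint_minus[OF linear_compose[OF linear_varphi_tilde[OF det] lin]]
  let ?K = "\<lambda>i k. adjoint (pi_tilde i \<circ> inv (phi_tilde h a A U \<Omega>) \<circ> psi_tilde a A U k) (R i)"
  \<comment> \<open>\<open>Z\<close> stands for the \<open>Asym\<close> term of stage
    \<open>k\<close>. The Lagrangian side is \<open>b k\<close> times the defect of the Hamiltonian
    equation, and \<open>b k\<close> is nonzero.\<close>
  have first: "0 = h *\<^sub>R (\<Sum>i\<in>UNIV. b i *\<^sub>R ?K i k) + b k *\<^sub>R (\<mu> k + Z) \<longleftrightarrow>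
      \<mu> k = - Z + h *\<^sub>R (\<Sum>i\<in>UNIV. (b i / b k) *\<^sub>R - ?K i k)" for k Z
  proof -
    have bk: "b k \<noteq> 0" using assms(2) by blast
    have "h *\<^sub>R (\<Sum>i\<in>UNIV. b i *\<^sub>R ?K i k) + b k *\<^sub>R (\<mu> k + Z)
        = b k *\<^sub>R (\<mu> k - (- Z + h *\<^sub>R (\<Sum>i\<in>UNIV. (b i / b k) *\<^sub>R - ?K i k)))"
      using bk by (simp add: sum_negf scaleR_add_right scaleR_diff_right scaleR_sum_right mult_ac)
    then show ?thesis using bk by auto
  qed
  have second: "- p0 = h *\<^sub>R (\<Sum>i\<in>UNIV. b i *\<^sub>R F i) + Z \<longleftrightarrow>
      Z = - p0 + h *\<^sub>R (\<Sum>i\<in>UNIV. b i *\<^sub>R - F i)" for Z and F :: "'s \<Rightarrow> 'n skew"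
    by (auto simp: sum_negf algebra_simps)
  show ?thesis
    unfolding R adj first[symmetric] second[symmetric] grad_H(1) R_def[symmetric] \<mu>[rule_format, symmetric]
    by simp
qed

end
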